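(* The equation $xy^3 = y^3x$ (in the two free variables $x,y$) has finite satisfiability gap $\varepsilon = \frac{4}{27}$. That is, for every finite group $G$, either $\mathrm{ds}_G(xy^3=y^3x) = 1$ or $\mathrm{ds}_G(xy^3=y^3x) \leq 1 - \frac{4}{27}$.
   Context: For an equation $\varphi$ in the first-order language of group theory with $n$ free variables and a finite group $G$, the degree of satisfiability of $\varphi$ in $G$ is $\mathrm{ds}_G(\varphi) = \frac{|\{\overline{x} \in G^n : \varphi(\overline{x})\}|}{|G^n|}$. The equation $\varphi$ has finite satisfiability gap $\varepsilon > 0$ if for every finite group $G$ either $\mathrm{ds}_G(\varphi) = 1$ or $\mathrm{ds}_G(\varphi) \leq 1-\varepsilon$. *)

theory Defs
  imports Complex_Main "HOL-Library.FuncSet" "HOL-Algebra.Group"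
begin

text \<open>Terms and equations of the first-order language of groups, over variables of type \<open>'v\<close>;
  \<open>term_vars\<close> and \<open>eq_vars\<close> are the sets of variables that occur.\<close>

datatype (term_vars: 'v) group_term =
    Var 'v
  | Unit
  | Mult "'v group_term" "'v group_term"
  | Inverse "'v group_term"

datatype (eq_vars: 'v) group_equation =
  Equation "'v group_term" "'v group_term"

primrec term_val :: "('a, 'b) monoid_scheme \<Rightarrow> ('v \<Rightarrow> 'a) \<Rightarrow> 'v group_term \<Rightarrow> 'a" where
  "term_val G x (Var v) = x v"
| "term_val G x Unit = \<one>\<^bsub>G\<^esub>"
| "term_val G x (Mult s t) = term_val G x s \<otimes>\<^bsub>G\<^esub> term_val G x t"
| "term_val G x (Inverse t) = inv\<^bsub>G\<^esub> term_val G x t"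

primrec satisfies :: "('a, 'b) monoid_scheme \<Rightarrow> ('v \<Rightarrow> 'a) \<Rightarrow> 'v group_equation \<Rightarrow> bool" where
  "satisfies G x (Equation s t) \<longleftrightarrow> term_val G x s = term_val G x t"

text \<open>The tuples in \<open>G\<^sup>n\<close> are indexed by the \<open>n\<close> free variables of the equation themselves.\<close>

definition tuples :: "('a, 'b) monoid_scheme \<Rightarrow> 'v group_equation \<Rightarrow> ('v \<Rightarrow> 'a) set" where
  "tuples G \<phi> = (eq_vars \<phi> \<rightarrow>\<^sub>E carrier G)"

definition degree_of_satisfiability ::
    "('a, 'b) monoid_scheme \<Rightarrow> 'v group_equation \<Rightarrow> real" where
  "degree_of_satisfiability G \<phi> =
     real (card {x \<in> tuples G \<phi>. satisfies G x \<phi>}) / real (card (tuples G \<phi>))"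

text \<open>HOL cannot quantify over types inside a formula, so the type \<open>'a\<close> of group elements is a
  parameter; a theorem stated for an arbitrary \<open>'a\<close> speaks about all finite groups.\<close>

definition has_finite_satisfiability_gap ::
    "'a itself \<Rightarrow> 'v group_equation \<Rightarrow> real \<Rightarrow> bool" where
  "has_finite_satisfiability_gap _ \<phi> \<epsilon> \<longleftrightarrow>
     \<epsilon> > 0 \<and>
     (\<forall>G :: 'a monoid. group G \<and> finite (carrier G) \<longrightarrow>
        degree_of_satisfiability G \<phi> = 1 \<or> degree_of_satisfiability G \<phi> \<le> 1 - \<epsilon>)"

datatype xy = X | Y

definition commutes_with_cube :: "xy group_equation" where
  "commutes_with_cube =
     (let x = Var X; y = Var Y; y3 = Mult (Mult y y) y
      in Equation (Mult x y3) (Mult y3 x))"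

end

theory Submission
  imports Defs "HOL-Algebra.Multiplicative_Group" "HOL-Algebra.Sylow" "HOL-Algebra.Group_Action"
begin

text \<open>Let \<open>Z\<close> be the center of the finite group \<open>G\<close> and \<open>L\<close> the set of all \<open>y\<close> with \<open>y\<^sup>3 \<in> Z\<close>. An
element \<open>y\<close> contributes the \<open>|C(y\<^sup>3)|\<close> elements \<open>x\<close> that commute with \<open>y\<^sup>3\<close>. If all cubes are
central, the degree is 1. Otherwise suppose first that some noncentral cube has a centralizer \<open>M\<close> of
index 2. An element outside \<open>M\<close> has its cube outside \<open>M\<close>, so its cube is not central; hence
\<open>L \<subseteq> M\<close> and the degree is at most \<open>1/2 + 1/2 * 1/2 = 3/4\<close>. If all noncentral cubes have
centralizers of index at least 3, the degree is at most \<open>p + (1 - p)/3\<close> with \<open>p = |L|/|G|\<close>, which is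
at most \<open>23/27 = 1 - 4/27\<close> as soon as \<open>p \<le> 7/9\<close> (lemma \<open>card_commuting_with_cube_le\<close>).

The heart of the matter is therefore that a finite group in which more than \<open>7/9\<close> of the elements
satisfy \<open>x\<^sup>3 = 1\<close> has exponent 3; it is needed for \<open>G/Z\<close>, and lemma \<open>cubes_in_normal\<close> states it for
all quotients of \<open>G\<close> at once. Its source of information is that for every \<open>a\<close> more than \<open>1/3\<close> of the
elements \<open>x\<close> are such that \<open>x\<close>, \<open>xa\<close> and \<open>xa\<^sup>-\<^sup>1\<close> are all cube roots of one, and that \<open>a\<close> then
commutes with its conjugate \<open>x\<^sup>-\<^sup>1ax\<close>.

Such a group is a 3-group (\<open>order_power_of_three\<close>). Most cube roots of one commute with no
nontrivial element of order prime to 3, so their centralizers lie in Sylow 3-subgroups; by the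
previous remark, more than a third of the conjugates of such an element lie in one and the same
Sylow 3-subgroup. Counting makes the index of a Sylow 3-subgroup at most 5, and the indices 2, 4 and
5 are excluded by counting the fixed points of cube roots of one on its cosets.

A nontrivial 3-group has a nontrivial center, so by induction all cubes are central and the center
has exponent 3. The group modulo its center has exponent 3, hence class at most 3
(\<open>class_at_most_three\<close>), and the cube map into the center is a polynomial map; the bound \<open>7/9\<close>
reflects that a nonzero polynomial of degree 3 over the field with three elements is nonzero on at
least \<open>2/9\<close> of its arguments. The degree is lowered in steps. Multiplying \<open>x\<close> by a commutator \<open>c\<close>
changes the cube by \<open>c\<^sup>3[c,x,x]\<close>; this quadratic function of \<open>x\<close> is nontrivial on less than a third
of the group, hence trivial. It follows that \<open>x \<mapsto> [a,x,a]\<close> is a homomorphism that is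
trivial on more than a third of the group, hence trivial. Now the cube map itself is a homomorphism,
and it is trivial on more than a third of the group, hence trivial (\<open>exponent_three\<close>).\<close>

section \<open>Commutators\<close>

text \<open>The operator associates to the left, so \<open>a \<star> x \<star> y\<close> is the left-normed commutator \<open>[a,x,y]\<close>.\<close>

definition (in group) commutator :: "'a \<Rightarrow> 'a \<Rightarrow> 'a"  (infixl \<open>\<star>\<close> 75)
  where "a \<star> b = inv a \<otimes> inv b \<otimes> a \<otimes> b"

context group
begin

lemma left_cancel [simp]:
  "\<lbrakk>x \<in> carrier G; y \<in> carrier G; z \<in> carrier G\<rbrakk> \<Longrightarrow> x \<otimes> y = x \<otimes> z \<longleftrightarrow> y = z"
  by (simp add: Units_eq)

lemma cancel_inv_left: "x \<in> carrier G \<Longrightarrow> y \<in> carrier G \<Longrightarrow> inv x \<otimes> (x \<otimes> y) = y"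
  by (simp flip: m_assoc)

lemma cancel_left_inv: "x \<in> carrier G \<Longrightarrow> y \<in> carrier G \<Longrightarrow> x \<otimes> (inv x \<otimes> y) = y"
  by (simp flip: m_assoc)

text \<open>Together with the simplification rules for groups these rules reduce words in a free group to normal
form, so that simplification proves every commutator identity that holds in all groups.\<close>

lemmas word_simps = commutator_def m_assoc inv_mult_group cancel_inv_left cancel_left_inv

lemma commutator_closed [simp, intro]:
  "a \<in> carrier G \<Longrightarrow> b \<in> carrier G \<Longrightarrow> a \<star> b \<in> carrier G"
  by (simp add: commutator_def)

lemma commutator_eq_one_iff:
  "a \<in> carrier G \<Longrightarrow> b \<in> carrier G \<Longrightarrow> a \<star> b = \<one> \<longleftrightarrow> a \<otimes> b = b \<otimes> a"
proof -
  assume [simp]: "a \<in> carrier G" "b \<in> carrier G"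
  have "b \<otimes> a \<otimes> (a \<star> b) = a \<otimes> b" by (simp add: word_simps)
  then show ?thesis
    using l_cancel_one[of "b \<otimes> a" "a \<star> b"] by simp
qed

lemma conj_eq_mult_commutator:
  "a \<in> carrier G \<Longrightarrow> x \<in> carrier G \<Longrightarrow> inv x \<otimes> a \<otimes> x = a \<otimes> (a \<star> x)"
  by (simp add: word_simps)

lemma inv_commutator:
  "a \<in> carrier G \<Longrightarrow> b \<in> carrier G \<Longrightarrow> inv (a \<star> b) = b \<star> a"
  by (simp add: word_simps)

lemma commutator_mult_right:
  "\<lbrakk>a \<in> carrier G; x \<in> carrier G; y \<in> carrier G\<rbrakk> \<Longrightarrow>
    a \<star> (x \<otimes> y) = (a \<star> y) \<otimes> (a \<star> x) \<otimes> (a \<star> x \<star> y)"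
  by (simp add: word_simps)

lemma commutator_mult_left:
  "\<lbrakk>a \<in> carrier G; b \<in> carrier G; x \<in> carrier G\<rbrakk> \<Longrightarrow>
    (a \<otimes> b) \<star> x = inv b \<otimes> (a \<star> x) \<otimes> b \<otimes> (b \<star> x)"
  by (simp add: word_simps)

lemma pow3: "x \<in> carrier G \<Longrightarrow> x [^] (3::nat) = x \<otimes> (x \<otimes> x)"
  by (simp add: numeral_3_eq_3 m_assoc)

definition commuting :: "'a \<Rightarrow> 'a \<Rightarrow> bool" where
  "commuting a b \<longleftrightarrow> a \<otimes> b = b \<otimes> a"

lemma commuting_sym: "commuting a b \<Longrightarrow> commuting b a"
  by (simp add: commuting_def)

lemma commuting_mult:
  assumes "commuting a b" "commuting a c" "a \<in> carrier G" "b \<in> carrier G" "c \<in> carrier G"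
  shows "commuting a (b \<otimes> c)"
proof -
  have "a \<otimes> (b \<otimes> c) = (a \<otimes> b) \<otimes> c" using assms by (simp add: m_assoc)
  also have "\<dots> = b \<otimes> (a \<otimes> c)" using assms by (simp add: m_assoc commuting_def)
  also have "\<dots> = (b \<otimes> c) \<otimes> a" using assms by (simp add: m_assoc commuting_def)
  finally show ?thesis by (simp add: commuting_def)
qed

lemma commuting_inv:
  assumes "commuting a b" "a \<in> carrier G" "b \<in> carrier G"
  shows "commuting a (inv b)"
proof -
  have "a \<otimes> inv b = inv b \<otimes> (b \<otimes> a) \<otimes> inv b"
    using assms(2,3) by (simp add: word_simps)
  also have "b \<otimes> a = a \<otimes> b"
    using assms(1) by (simp add: commuting_def)
  finally show ?thesis
    using assms(2,3) by (simp add: commuting_def m_assoc)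
qed

lemma commuting_conj_iff:
  assumes "a \<in> carrier G" "b \<in> carrier G" "x \<in> carrier G"
  shows "commuting (inv x \<otimes> a \<otimes> x) (inv x \<otimes> b \<otimes> x) \<longleftrightarrow> commuting a b"
proof -
  have *: "(inv x \<otimes> a \<otimes> x) \<otimes> (inv x \<otimes> b \<otimes> x) = inv x \<otimes> (a \<otimes> b) \<otimes> x"
    "(inv x \<otimes> b \<otimes> x) \<otimes> (inv x \<otimes> a \<otimes> x) = inv x \<otimes> (b \<otimes> a) \<otimes> x"
    using assms by (simp_all add: word_simps)
  show ?thesis unfolding commuting_def * using assms by simp
qed

text \<open>Put \<open>b = x\<^sup>-\<^sup>1ax\<close> and \<open>c = x\<^sup>-\<^sup>1bx\<close>. Then \<open>(xa)\<^sup>3 = x\<^sup>3cba\<close> and \<open>(xa\<^sup>-\<^sup>1)\<^sup>3 = x\<^sup>3c\<^sup>-\<^sup>1b\<^sup>-\<^sup>1a\<^sup>-\<^sup>1\<close>, so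
\<open>c\<^sup>-\<^sup>1\<close> equals both \<open>ba\<close> and \<open>ab\<close>.\<close>

lemma commuting_conj_if_cubes_trivial:
  assumes [simp]: "x \<in> carrier G" "a \<in> carrier G"
    and "x [^] (3::nat) = \<one>" "(x \<otimes> a) [^] (3::nat) = \<one>" "(x \<otimes> inv a) [^] (3::nat) = \<one>"
  shows "commuting a (inv x \<otimes> a \<otimes> x)"
proof -
  define b c where "b = inv x \<otimes> a \<otimes> x" and "c = inv x \<otimes> b \<otimes> x"
  have [simp]: "b \<in> carrier G" "c \<in> carrier G" by (simp_all add: b_def c_def)
  have "(x \<otimes> a) [^] (3::nat) = x [^] (3::nat) \<otimes> (c \<otimes> (b \<otimes> a))"
    by (simp add: b_def c_def word_simps pow3)
  then have "c \<otimes> (b \<otimes> a) = \<one>" using assms by simp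
  then have 1: "inv c = b \<otimes> a" by (metis \<open>b \<in> carrier G\<close> \<open>c \<in> carrier G\<close> assms(2) inv_equality inv_inv m_closed)
  have "(x \<otimes> inv a) [^] (3::nat) = x [^] (3::nat) \<otimes> (inv c \<otimes> inv (a \<otimes> b))"
    by (simp add: b_def c_def word_simps pow3)
  then have "inv c \<otimes> inv (a \<otimes> b) = \<one>" using assms by simp
  then have "inv c = a \<otimes> b" by (metis \<open>b \<in> carrier G\<close> \<open>c \<in> carrier G\<close> assms(2) inv_closed inv_equality inv_inv m_closed)
  with 1 show ?thesis by (simp add: commuting_def b_def)
qed

end

section \<open>Groups of exponent three\<close>

locale exponent_three_group = group +
  assumes pow3_eq_one: "x \<in> carrier G \<Longrightarrow> x [^] (3::nat) = \<one>"
begin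

lemma commuting_conj:
  "\<lbrakk>a \<in> carrier G; x \<in> carrier G\<rbrakk> \<Longrightarrow> commuting a (inv x \<otimes> a \<otimes> x)"
  by (rule commuting_conj_if_cubes_trivial) (simp_all add: pow3_eq_one)

text \<open>This is the centralizer of the normal closure of \<open>x\<close>. In a group of exponent 3 the conjugates of \<open>x\<close>
commute pairwise, so it contains \<open>x\<close> and every commutator that involves \<open>x\<close>.\<close>

definition normal_closure_centralizer :: "'a \<Rightarrow> 'a set" where
  "normal_closure_centralizer x =
    {n \<in> carrier G. \<forall>g \<in> carrier G. commuting n (inv g \<otimes> x \<otimes> g)}"

lemma normal_closure_centralizer_self:
  "x \<in> carrier G \<Longrightarrow> x \<in> normal_closure_centralizer x"
  by (simp add: normal_closure_centralizer_def commuting_conj)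

lemma normal_closure_centralizer_mult:
  assumes "x \<in> carrier G" "m \<in> normal_closure_centralizer x" "n \<in> normal_closure_centralizer x"
  shows "m \<otimes> n \<in> normal_closure_centralizer x"
proof -
  have "commuting (m \<otimes> n) z" if "z \<in> carrier G" "commuting m z" "commuting n z"
      "m \<in> carrier G" "n \<in> carrier G" for z
    using commuting_sym[OF commuting_mult[OF that(2,3)[THEN commuting_sym] that(1,4,5)]] .
  then show ?thesis using assms by (simp add: normal_closure_centralizer_def)
qed

lemma normal_closure_centralizer_inv:
  assumes "x \<in> carrier G" "n \<in> normal_closure_centralizer x"
  shows "inv n \<in> normal_closure_centralizer x"
proof -
  have "commuting (inv n) z" if "z \<in> carrier G" "commuting n z" "n \<in> carrier G" for z
    using commuting_sym[OF commuting_inv[OF that(2)[THEN commuting_sym] that(1,3)]] .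
  then show ?thesis using assms by (simp add: normal_closure_centralizer_def)
qed

lemma normal_closure_centralizer_conj:
  assumes x: "x \<in> carrier G" and n: "n \<in> normal_closure_centralizer x" and y: "y \<in> carrier G"
  shows "inv y \<otimes> n \<otimes> y \<in> normal_closure_centralizer x"
proof -
  have [simp]: "n \<in> carrier G" using n by (simp add: normal_closure_centralizer_def)
  have "commuting (inv y \<otimes> n \<otimes> y) (inv g \<otimes> x \<otimes> g)" if g: "g \<in> carrier G" for g
  proof -
    have "commuting n (inv (g \<otimes> inv y) \<otimes> x \<otimes> (g \<otimes> inv y))"
      using n g y by (simp add: normal_closure_centralizer_def del: inv_mult_group)
    then have "commuting (inv y \<otimes> n \<otimes> y) (inv y \<otimes> (inv (g \<otimes> inv y) \<otimes> x \<otimes> (g \<otimes> inv y)) \<otimes> y)"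
      using g x y by (simp add: commuting_conj_iff)
    also have "inv y \<otimes> (inv (g \<otimes> inv y) \<otimes> x \<otimes> (g \<otimes> inv y)) \<otimes> y = inv g \<otimes> x \<otimes> g"
      using g x y by (simp add: word_simps)
    finally show ?thesis .
  qed
  then show ?thesis using y by (simp add: normal_closure_centralizer_def)
qed

lemma normal_closure_centralizer_commutator:
  assumes "x \<in> carrier G" "n \<in> normal_closure_centralizer x" "y \<in> carrier G"
  shows "n \<star> y \<in> normal_closure_centralizer x"
proof -
  have "n \<in> carrier G" using assms by (simp add: normal_closure_centralizer_def)
  then have "n \<star> y = inv n \<otimes> (inv y \<otimes> n \<otimes> y)"
    using assms by (simp add: word_simps)
  then show ?thesis using assms
    by (simp add: normal_closure_centralizer_mult normal_closure_centralizer_inv normal_closure_centralizer_conj)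
qed

lemma commutator_in_normal_closure_centralizer_left:
  "\<lbrakk>x \<in> carrier G; y \<in> carrier G\<rbrakk> \<Longrightarrow> x \<star> y \<in> normal_closure_centralizer x"
  by (simp add: normal_closure_centralizer_commutator normal_closure_centralizer_self)

lemma commutator_in_normal_closure_centralizer_right:
  "\<lbrakk>x \<in> carrier G; y \<in> carrier G\<rbrakk> \<Longrightarrow> y \<star> x \<in> normal_closure_centralizer x"
  using commutator_in_normal_closure_centralizer_left[of x y] normal_closure_centralizer_inv[of x "x \<star> y"]
  by (simp add: inv_commutator)

lemma normal_closure_centralizer_commuting:
  assumes "n \<in> normal_closure_centralizer x" "x \<in> carrier G"
  shows "commuting n x"
proof -
  have "commuting n (inv \<one> \<otimes> x \<otimes> \<one>)"
    using assms(1) unfolding normal_closure_centralizer_def by blast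
  then show ?thesis using assms by simp
qed

lemma normal_closure_centralizer_commuting_commutator:
  assumes n: "n \<in> normal_closure_centralizer x" and x: "x \<in> carrier G" and y: "y \<in> carrier G"
  shows "commuting n (x \<star> y)"
proof -
  have nc: "n \<in> carrier G" using n by (simp add: normal_closure_centralizer_def)
  have "x \<star> y = inv x \<otimes> (inv y \<otimes> x \<otimes> y)"
    using x y by (simp add: word_simps)
  moreover have "commuting n (inv x)"
    using normal_closure_centralizer_commuting[OF n x] x nc by (rule_tac commuting_inv)
  moreover have "commuting n (inv y \<otimes> x \<otimes> y)"
    using n y by (simp add: normal_closure_centralizer_def)
  ultimately show ?thesis using x y nc by (simp add: commuting_mult)
qed

lemma normal_closure_centralizer_commuting_commutator':
  assumes "n \<in> normal_closure_centralizer x" "x \<in> carrier G" "y \<in> carrier G"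
  shows "commuting n (y \<star> x)"
proof -
  have "n \<in> carrier G" using assms(1) by (simp add: normal_closure_centralizer_def)
  then show ?thesis
    using commuting_inv[OF normal_closure_centralizer_commuting_commutator[OF assms]] assms(2,3)
    by (simp add: inv_commutator)
qed

lemma commutator_engel:
  assumes [simp]: "a \<in> carrier G" "x \<in> carrier G"
  shows "a \<star> x \<star> a = \<one>" and "a \<star> x \<star> x = \<one>"
  using normal_closure_centralizer_commuting[OF commutator_in_normal_closure_centralizer_left[of a x]]
    normal_closure_centralizer_commuting[OF commutator_in_normal_closure_centralizer_right[of x a]]
  by (simp_all add: commutator_eq_one_iff commuting_def)

text \<open>Expand \<open>[b,xy] = [b,y][b,x][b,x,y]\<close>. This element commutes with \<open>xy\<close>, and so does \<open>[b,x,y]\<close>, which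
commutes with both \<open>x\<close> and \<open>y\<close>. Hence \<open>[b,y][b,x]\<close> commutes with \<open>xy\<close>, and expanding that commutator
leaves \<open>[b,y,x][b,x,y] = 1\<close>.\<close>

lemma commutator_swap_last:
  assumes [simp]: "b \<in> carrier G" "x \<in> carrier G" "y \<in> carrier G"
  shows "b \<star> y \<star> x = inv (b \<star> x \<star> y)"
proof -
  define p q r where "p = b \<star> x" and "q = b \<star> y" and "r = b \<star> x \<star> y"
  have [simp]: "p \<in> carrier G" "q \<in> carrier G" "r \<in> carrier G"
    by (simp_all add: p_def q_def r_def)
  have px: "p \<in> normal_closure_centralizer x" and qy: "q \<in> normal_closure_centralizer y"
    by (simp_all add: p_def q_def commutator_in_normal_closure_centralizer_right)
  have rx: "r \<in> normal_closure_centralizer x" and ry: "r \<in> normal_closure_centralizer y"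
    using px by (simp_all add: r_def normal_closure_centralizer_commutator commutator_in_normal_closure_centralizer_right flip: p_def)
  have com: "commuting (q \<otimes> p \<otimes> r) (x \<otimes> y)"
  proof -
    have "b \<star> (x \<otimes> y) = q \<otimes> p \<otimes> r"
      by (simp add: commutator_mult_right p_def q_def r_def)
    then show ?thesis
      using normal_closure_centralizer_commuting[OF commutator_in_normal_closure_centralizer_right[of "x \<otimes> y" b]]
      by simp
  qed
  have crxy: "commuting r (x \<otimes> y)"
    using rx ry by (simp add: commuting_mult normal_closure_centralizer_commuting)
  have qpxy: "commuting (q \<otimes> p) (x \<otimes> y)"
  proof -
    have "q \<otimes> p \<otimes> r \<otimes> inv r = q \<otimes> p" by (simp add: m_assoc)
    moreover have "commuting (x \<otimes> y) (q \<otimes> p \<otimes> r \<otimes> inv r)"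
      by (rule commuting_mult[OF commuting_sym[OF com] commuting_inv[OF commuting_sym[OF crxy]]]) simp_all
    ultimately show ?thesis by (simp add: commuting_sym)
  qed
  have q_x: "q \<star> x \<in> normal_closure_centralizer b"  "q \<star> x \<in> normal_closure_centralizer x"
    "q \<star> x \<in> normal_closure_centralizer y"
    using qy by (simp_all add: normal_closure_centralizer_commutator commutator_in_normal_closure_centralizer_left
      commutator_in_normal_closure_centralizer_right q_def)
  have q1: "q \<star> (x \<otimes> y) = q \<star> x"
  proof -
    have "q \<star> y = \<one>" using normal_closure_centralizer_commuting[OF qy]
      by (simp add: commutator_eq_one_iff commuting_def)
    moreover have "q \<star> x \<star> y = \<one>" using normal_closure_centralizer_commuting[OF q_x(3)]
      by (simp add: commutator_eq_one_iff commuting_def)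
    ultimately show ?thesis by (simp add: commutator_mult_right)
  qed
  have p1: "p \<star> (x \<otimes> y) = r"
  proof -
    have "p \<star> x = \<one>" using normal_closure_centralizer_commuting[OF px]
      by (simp add: commutator_eq_one_iff commuting_def)
    moreover have "\<one> \<star> y = \<one>" by (simp add: commutator_def)
    ultimately show ?thesis by (simp add: commutator_mult_right p_def r_def)
  qed
  have "commuting (q \<star> x) p"
    using normal_closure_centralizer_commuting_commutator[OF q_x(1)] by (simp add: p_def)
  then have "inv p \<otimes> (q \<star> x) \<otimes> p = q \<star> x"
    by (simp add: commuting_def m_assoc cancel_inv_left)
  then have "(q \<otimes> p) \<star> (x \<otimes> y) = (q \<star> x) \<otimes> r"
    by (simp add: commutator_mult_left q1 p1)
  moreover have "(q \<otimes> p) \<star> (x \<otimes> y) = \<one>"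
    using qpxy by (subst commutator_eq_one_iff) (simp_all add: commuting_def)
  ultimately have "(q \<star> x) \<otimes> r = \<one>" by simp
  then show ?thesis by (simp add: q_def r_def inv_equality)
qed

lemma commutator_inv_left:
  assumes [simp]: "u \<in> carrier G" "y \<in> carrier G"
  shows "inv u \<star> y = inv (u \<star> y)"
proof -
  have "commuting (u \<star> y) u"
    by (simp add: normal_closure_centralizer_commuting commutator_in_normal_closure_centralizer_left)
  then have "commuting u (inv (u \<star> y))"
    by (intro commuting_inv) (simp_all add: commuting_sym)
  moreover have "inv u \<star> y = u \<otimes> inv (u \<star> y) \<otimes> inv u"
    by (simp add: word_simps)
  ultimately show ?thesis
    by (simp add: commuting_def m_assoc)
qed

text \<open>Compare the expansions of \<open>u \<star> (y \<otimes> z)\<close> and of \<open>u \<star> ((z \<otimes> y) \<otimes> (y \<star> z))\<close>, whose right arguments are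
equal. The factors \<open>u \<star> y\<close>, \<open>u \<star> z\<close> and \<open>u \<star> y \<star> z\<close> commute with each other and with
\<open>y \<star> z\<close>, and the comparison gives \<open>u \<star> (y \<star> z) = r\<^sup>2 = r\<^sup>-\<^sup>1\<close> with \<open>r = u \<star> y \<star> z\<close>.\<close>

lemma commutator_commutator:
  assumes [simp]: "u \<in> carrier G" "y \<in> carrier G" "z \<in> carrier G"
  shows "u \<star> (y \<star> z) = inv (u \<star> y \<star> z)"
proof -
  define p q r k where "p = u \<star> y" and "q = u \<star> z" and "r = p \<star> z" and "k = y \<star> z"
  have [simp]: "p \<in> carrier G" "q \<in> carrier G" "r \<in> carrier G" "k \<in> carrier G"
    by (simp_all add: p_def q_def r_def k_def)
  have pu: "p \<in> normal_closure_centralizer u" and py: "p \<in> normal_closure_centralizer y"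
    and qz: "q \<in> normal_closure_centralizer z" and rz: "r \<in> normal_closure_centralizer z"
    by (simp_all add: p_def q_def r_def commutator_in_normal_closure_centralizer_right
        commutator_in_normal_closure_centralizer_left)
  have ru: "r \<in> normal_closure_centralizer u"
    using pu by (simp add: r_def normal_closure_centralizer_commutator)
  have pq: "commuting p q" and rp: "commuting r p" and rq: "commuting r q"
    using normal_closure_centralizer_commuting_commutator[OF pu] normal_closure_centralizer_commuting_commutator[OF ru]
    by (simp_all add: p_def q_def)
  have pk: "commuting k p" and qk: "commuting k q" and rk: "commuting k r"
    using normal_closure_centralizer_commuting_commutator[OF py]
      normal_closure_centralizer_commuting_commutator'[OF qz] normal_closure_centralizer_commuting_commutator'[OF rz]
    by (simp_all add: k_def commuting_sym)
  have q_y: "q \<star> y = inv r"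
    using commutator_swap_last[of u y z] by (simp add: q_def r_def p_def)
  define e where "e = u \<star> (z \<otimes> y)"
  have e: "e = p \<otimes> q \<otimes> inv r"
    by (simp add: e_def commutator_mult_right q_y flip: p_def q_def)
  have [simp]: "e \<in> carrier G" by (simp add: e_def)
  have "commuting k e"
    unfolding e by (intro commuting_mult commuting_inv pk qk rk) simp_all
  then have ek: "e \<star> k = \<one>"
    by (simp add: commutator_eq_one_iff commuting_def)
  have "y \<otimes> z = (z \<otimes> y) \<otimes> k"
    by (simp add: k_def word_simps)
  then have "u \<star> (y \<otimes> z) = u \<star> ((z \<otimes> y) \<otimes> k)" by simp
  then have "q \<otimes> p \<otimes> r = (u \<star> k) \<otimes> e"
    by (simp add: commutator_mult_right[of u y z] commutator_mult_right[of u "z \<otimes> y" k] ek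
        flip: e_def p_def q_def r_def)
  then have "u \<star> k = q \<otimes> p \<otimes> r \<otimes> inv e"
    by (simp add: inv_solve_right)
  also have "inv e = r \<otimes> inv q \<otimes> inv p"
    by (simp add: e inv_mult_group m_assoc)
  also have "q \<otimes> p \<otimes> r \<otimes> (r \<otimes> inv q \<otimes> inv p) = r \<otimes> r"
  proof -
    have "q \<otimes> p \<otimes> r \<otimes> r = r \<otimes> r \<otimes> (p \<otimes> q)"
    proof -
      have "commuting (p \<otimes> q) (r \<otimes> r)"
        using rp rq by (intro commuting_mult) (simp_all add: commuting_sym commuting_mult)
      then have "p \<otimes> q \<otimes> (r \<otimes> r) = r \<otimes> r \<otimes> (p \<otimes> q)" by (simp only: commuting_def)
      moreover have "q \<otimes> p = p \<otimes> q" using pq by (simp add: commuting_def)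
      ultimately show ?thesis by (simp add: m_assoc)
    qed
    moreover have "q \<otimes> p \<otimes> r \<otimes> (r \<otimes> inv q \<otimes> inv p) = q \<otimes> p \<otimes> r \<otimes> r \<otimes> (inv q \<otimes> inv p)"
      by (simp add: m_assoc)
    ultimately have "q \<otimes> p \<otimes> r \<otimes> (r \<otimes> inv q \<otimes> inv p) = r \<otimes> r \<otimes> (p \<otimes> q) \<otimes> (inv q \<otimes> inv p)"
      by simp
    then show ?thesis by (simp add: word_simps)
  qed
  also have "r \<otimes> r = inv r"
  proof -
    have "(r \<otimes> r) \<otimes> r = \<one>" using pow3_eq_one[of r] by (simp add: pow3 m_assoc)
    then show ?thesis by (simp add: inv_equality)
  qed
  finally show ?thesis by (simp add: r_def p_def k_def)
qed

text \<open>The commutator \<open>t = [a,x,y,z]\<close> changes to its inverse under every transposition of neighbouring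
arguments. By lemma \<open>commutator_commutator\<close>, \<open>[[a,x],[y,z]] = t\<^sup>-\<^sup>1\<close>. The same element is the inverse
of \<open>[[y,z],[a,x]] = [y,z,a,x]\<^sup>-\<^sup>1\<close>, and \<open>[y,z,a,x] = t\<close> since the permutation is even. So \<open>t = t\<^sup>-\<^sup>1\<close>.\<close>

theorem class_at_most_three:
  assumes [simp]: "a \<in> carrier G" "x \<in> carrier G" "y \<in> carrier G" "z \<in> carrier G"
  shows "a \<star> x \<star> y \<star> z = \<one>"
proof -
  define t where "t = a \<star> x \<star> y \<star> z"
  have [simp]: "t \<in> carrier G" by (simp add: t_def)
  have swap12: "c \<star> b \<star> d \<star> e = inv (b \<star> c \<star> d \<star> e)"
    if "b \<in> carrier G" "c \<in> carrier G" "d \<in> carrier G" "e \<in> carrier G" for b c d e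
  proof -
    have "c \<star> b = inv (b \<star> c)" using that by (simp add: inv_commutator)
    then show ?thesis using that by (simp add: commutator_inv_left del: inv_mult_group)
  qed
  have swap23: "b \<star> d \<star> c \<star> e = inv (b \<star> c \<star> d \<star> e)"
    if "b \<in> carrier G" "c \<in> carrier G" "d \<in> carrier G" "e \<in> carrier G" for b c d e
  proof -
    have "b \<star> d \<star> c = inv (b \<star> c \<star> d)" using that by (intro commutator_swap_last)
    then show ?thesis using that by (simp add: commutator_inv_left)
  qed
  have swap34: "b \<star> c \<star> e \<star> d = inv (b \<star> c \<star> d \<star> e)"
    if "b \<in> carrier G" "c \<in> carrier G" "d \<in> carrier G" "e \<in> carrier G" for b c d e
    using that by (intro commutator_swap_last) simp_all
  have "y \<star> z \<star> a \<star> x = inv (y \<star> a \<star> z \<star> x)" by (rule swap23) simp_all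
  also have "y \<star> a \<star> z \<star> x = inv (a \<star> y \<star> z \<star> x)" by (rule swap12) simp_all
  also have "a \<star> y \<star> z \<star> x = inv (a \<star> y \<star> x \<star> z)" by (rule swap34) simp_all
  also have "a \<star> y \<star> x \<star> z = inv t" unfolding t_def by (rule swap23) simp_all
  finally have yzax: "y \<star> z \<star> a \<star> x = t" by simp
  have "inv t = (a \<star> x) \<star> (y \<star> z)"
    by (simp add: commutator_commutator t_def)
  also have "\<dots> = inv ((y \<star> z) \<star> (a \<star> x))"
    by (simp add: inv_commutator)
  also have "\<dots> = t"
    by (simp add: commutator_commutator yzax)
  finally have "t \<otimes> t = \<one>" by (metis \<open>t \<in> carrier G\<close> l_inv)
  then have "t = \<one>" using pow3_eq_one[of t] by (simp add: pow3)
  then show ?thesis by (simp add: t_def)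
qed

end

section \<open>Density of the cube roots of one\<close>

context group
begin

lemma card_right_translate:
  assumes "a \<in> carrier G" "A \<subseteq> carrier G"
  shows "card {x \<in> carrier G. x \<otimes> a \<in> A} = card A"
proof -
  have "bij_betw (\<lambda>x. x \<otimes> a) {x \<in> carrier G. x \<otimes> a \<in> A} A"
    by (rule bij_betwI[where g = "\<lambda>y. y \<otimes> inv a"]) (use assms in \<open>auto simp: m_assoc\<close>)
  then show ?thesis by (rule bij_betw_same_card)
qed

abbreviation translates_in :: "'a set \<Rightarrow> 'a \<Rightarrow> 'a \<Rightarrow> nat" where
  "translates_in A a x \<equiv>
    of_bool (x \<in> A) + of_bool (x \<otimes> a \<in> A) + of_bool (x \<otimes> inv a \<in> A)"

text \<open>Every density argument about \<open>A\<close> below examines the elements \<open>x\<close>, \<open>xa\<close> and \<open>xa\<^sup>-\<^sup>1\<close> together. As \<open>x\<close>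
runs through the group, so does each of the three, whence the factor 3.\<close>

lemma sum_translates_in:
  assumes fin: "finite (carrier G)" and a: "a \<in> carrier G" and A: "A \<subseteq> carrier G"
  shows "(\<Sum>x\<in>carrier G. translates_in A a x) = 3 * card A"
proof -
  have "(\<Sum>x\<in>carrier G. of_bool (P x) :: nat) = card {x \<in> carrier G. P x}" for P :: "'a \<Rightarrow> bool"
  proof -
    have "carrier G \<inter> {x. P x} = {x \<in> carrier G. P x}" by auto
    then show ?thesis using fin by simp
  qed
  moreover have "{x \<in> carrier G. x \<in> A} = A" using A by blast
  ultimately show ?thesis
    using card_right_translate[OF a A] card_right_translate[of "inv a" A] a A
    by (simp add: sum.distrib)
qed

lemma card_le_translates:
  assumes "finite (carrier G)" "a \<in> carrier G" "A \<subseteq> carrier G" "B \<subseteq> carrier G"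
    and "\<And>x. x \<in> B \<Longrightarrow> k \<le> translates_in A a x"
  shows "k * card B \<le> 3 * card A"
proof -
  have "k * card B = (\<Sum>x\<in>B. k)" by simp
  also have "\<dots> \<le> (\<Sum>x\<in>B. translates_in A a x)"
    using assms(5) by (rule sum_mono)
  also have "\<dots> \<le> (\<Sum>x\<in>carrier G. translates_in A a x)"
    using assms(1,4) by (intro sum_mono2) auto
  finally show ?thesis using assms by (simp only: sum_translates_in)
qed

lemma translates_le_card:
  assumes "finite (carrier G)" "a \<in> carrier G" "A \<subseteq> carrier G"
    and "\<And>x. x \<in> carrier G \<Longrightarrow> translates_in A a x \<le> k"
  shows "3 * card A \<le> k * order G"
proof -
  have "(\<Sum>x\<in>carrier G. translates_in A a x) \<le> (\<Sum>x\<in>carrier G. k)"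
    using assms(4) by (rule sum_mono)
  then show ?thesis using assms by (simp add: sum_translates_in order_def mult.commute)
qed

definition cube_roots :: "'a set" where
  "cube_roots = {x \<in> carrier G. x [^] (3::nat) = \<one>}"

definition many_cube_roots :: bool where
  "many_cube_roots \<longleftrightarrow> finite (carrier G) \<and> 7 * order G < 9 * card cube_roots"

text \<open>Each of the three conditions fails on less than \<open>2/9\<close> of the group, so at least one of them fails on
less than \<open>2/3\<close>.\<close>

lemma card_three_cube_roots:
  assumes "many_cube_roots" and a: "a \<in> carrier G"
  shows "order G <
    3 * card {x \<in> carrier G. x \<in> cube_roots \<and> x \<otimes> a \<in> cube_roots \<and> x \<otimes> inv a \<in> cube_roots}"
proof -
  have fin: "finite (carrier G)" and many: "7 * order G < 9 * card cube_roots"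
    using assms by (simp_all add: many_cube_roots_def)
  let ?T = "{x \<in> carrier G. x \<in> cube_roots \<and> x \<otimes> a \<in> cube_roots \<and> x \<otimes> inv a \<in> cube_roots}"
  have "1 * card (carrier G - ?T) \<le> 3 * card (carrier G - cube_roots)"
    by (rule card_le_translates[OF fin a]) (use a in auto)
  moreover have "card (carrier G - ?T) = order G - card ?T"
    unfolding order_def using fin by (intro card_Diff_subset) auto
  moreover have "card (carrier G - cube_roots) = order G - card cube_roots"
    unfolding order_def using fin
    by (intro card_Diff_subset) (auto simp: cube_roots_def)
  moreover have "card ?T \<le> order G"
    unfolding order_def using fin by (intro card_mono) auto
  moreover have "card cube_roots \<le> order G"
    unfolding order_def using fin by (intro card_mono) (auto simp: cube_roots_def)
  ultimately show ?thesis using many by linarith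
qed

end

section \<open>The center and its quotient\<close>

definition center :: "('a, 'b) monoid_scheme \<Rightarrow> 'a set" where
  "center G = {z \<in> carrier G. \<forall>g \<in> carrier G. z \<otimes>\<^bsub>G\<^esub> g = g \<otimes>\<^bsub>G\<^esub> z}"

context group
begin

lemma center_carrier: "z \<in> center G \<Longrightarrow> z \<in> carrier G"
  by (simp add: center_def)

lemma center_commute: "z \<in> center G \<Longrightarrow> g \<in> carrier G \<Longrightarrow> z \<otimes> g = g \<otimes> z"
  by (simp add: center_def)

lemma center_left_commute:
  "\<lbrakk>z \<in> center G; g \<in> carrier G; h \<in> carrier G\<rbrakk> \<Longrightarrow> z \<otimes> (g \<otimes> h) = g \<otimes> (z \<otimes> h)"
  by (metis center_commute center_carrier m_assoc)

lemma center_subgroup: "subgroup (center G) G"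
proof
  show "center G \<subseteq> carrier G" by (auto simp: center_def)
next
  fix y z assume y: "y \<in> center G" and z: "z \<in> center G"
  then have [simp]: "y \<in> carrier G" "z \<in> carrier G" by (simp_all add: center_carrier)
  have "y \<otimes> z \<otimes> g = g \<otimes> (y \<otimes> z)" if "g \<in> carrier G" for g
    using that y z by (simp add: m_assoc center_commute[of z] center_left_commute[of y])
  then show "y \<otimes> z \<in> center G" by (simp add: center_def)
next
  show "\<one> \<in> center G" by (simp add: center_def)
next
  fix z assume z: "z \<in> center G"
  then have "commuting g (inv z)" if "g \<in> carrier G" for g
    using that by (intro commuting_inv) (simp_all add: center_carrier center_commute commuting_def)
  then show "inv z \<in> center G" using z by (simp add: center_def commuting_def)
qed

lemmas center_mult = subgroup.m_closed[OF center_subgroup]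
  and center_inv = subgroup.m_inv_closed[OF center_subgroup]
  and center_one = subgroup.one_closed[OF center_subgroup]

lemma center_normal: "center G \<lhd> G"
proof (rule normalI[OF center_subgroup], rule ballI)
  fix x assume x: "x \<in> carrier G"
  then show "center G #> x = x <# center G"
    by (auto simp: r_coset_def l_coset_def) (metis center_commute)+
qed

lemma commutator_center:
  "\<lbrakk>z \<in> center G; g \<in> carrier G\<rbrakk> \<Longrightarrow> z \<star> g = \<one>"
  by (simp add: commutator_eq_one_iff center_carrier center_commute)

lemma conj_center:
  "\<lbrakk>z \<in> center G; g \<in> carrier G\<rbrakk> \<Longrightarrow> inv g \<otimes> z \<otimes> g = z"
  by (simp add: center_carrier center_commute m_assoc cancel_inv_left)

lemma commutator_mult_left_central:
  assumes "d \<star> y \<in> center G" "d \<in> carrier G" "d' \<in> carrier G" "y \<in> carrier G"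
  shows "(d \<otimes> d') \<star> y = (d \<star> y) \<otimes> (d' \<star> y)"
  using assms by (simp add: commutator_mult_left conj_center)

end

lemma (in group_hom) hom_commutator:
  "\<lbrakk>a \<in> carrier G; b \<in> carrier G\<rbrakk> \<Longrightarrow> h (G.commutator a b) = H.commutator (h a) (h b)"
  by (simp add: G.commutator_def H.commutator_def)

lemma (in normal) quotient_eq_one_iff:
  "x \<in> carrier G \<Longrightarrow> H #> x = \<one>\<^bsub>G Mod H\<^esub> \<longleftrightarrow> x \<in> H"
  by (metis one_FactGroup coset_join1 coset_join2 is_group subgroup_axioms subset)

lemma (in normal) quotient_hom: "group_hom G (G Mod H) (\<lambda>x. H #> x)"
  by (intro group_hom.intro group_hom_axioms.intro is_group factorgroup_is_group r_coset_hom_Mod)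

section \<open>Groups with central cubes\<close>

text \<open>In these groups the cube map takes values in a central subgroup that is a vector space over the
field with three elements.\<close>

locale central_cubes_group = group +
  assumes pow3_in_center: "x \<in> carrier G \<Longrightarrow> x [^] (3::nat) \<in> center G"
    and center_pow3: "z \<in> center G \<Longrightarrow> z [^] (3::nat) = \<one>"
begin

lemma quotient_exponent_three: "exponent_three_group (G Mod center G)"
proof -
  interpret normal "center G" G by (rule center_normal)
  interpret Q: group_hom G "G Mod center G" "\<lambda>x. center G #> x" by (rule quotient_hom)
  show ?thesis
  proof
    fix C assume "C \<in> carrier (G Mod center G)"
    then obtain x where x: "x \<in> carrier G" "C = center G #> x"
      by (auto simp: FactGroup_def RCOSETS_def)
    then have "C [^]\<^bsub>G Mod center G\<^esub> (3::nat) = center G #> (x [^] (3::nat))"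
      using Q.hom_nat_pow by simp
    then show "C [^]\<^bsub>G Mod center G\<^esub> (3::nat) = \<one>\<^bsub>G Mod center G\<^esub>"
      using x pow3_in_center by (simp add: quotient_eq_one_iff del: one_FactGroup)
  qed
qed

lemma commutator4_in_center:
  assumes [simp]: "a \<in> carrier G" "x \<in> carrier G" "y \<in> carrier G" "z \<in> carrier G"
  shows "a \<star> x \<star> y \<star> z \<in> center G"
proof -
  interpret normal "center G" G by (rule center_normal)
  interpret Q: group_hom G "G Mod center G" "\<lambda>x. center G #> x" by (rule quotient_hom)
  interpret E: exponent_three_group "G Mod center G" by (rule quotient_exponent_three)
  have "center G #> (a \<star> x \<star> y \<star> z) = \<one>\<^bsub>G Mod center G\<^esub>"
    by (simp add: Q.hom_commutator E.class_at_most_three del: one_FactGroup)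
  then show ?thesis by (simp add: quotient_eq_one_iff del: one_FactGroup)
qed

lemma engel_in_center:
  assumes [simp]: "a \<in> carrier G" "x \<in> carrier G"
  shows "a \<star> x \<star> a \<in> center G" and "a \<star> x \<star> x \<in> center G"
proof -
  interpret normal "center G" G by (rule center_normal)
  interpret Q: group_hom G "G Mod center G" "\<lambda>x. center G #> x" by (rule quotient_hom)
  interpret E: exponent_three_group "G Mod center G" by (rule quotient_exponent_three)
  have "center G #> (a \<star> x \<star> a) = \<one>\<^bsub>G Mod center G\<^esub>"
    "center G #> (a \<star> x \<star> x) = \<one>\<^bsub>G Mod center G\<^esub>"
    by (simp_all add: Q.hom_commutator E.commutator_engel del: one_FactGroup)
  then show "a \<star> x \<star> a \<in> center G" "a \<star> x \<star> x \<in> center G"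
    by (simp_all add: quotient_eq_one_iff del: one_FactGroup)
qed

lemma center_order_three:
  assumes "w \<in> center G"
  shows "w \<otimes> (w \<otimes> w) = \<one>" and "y \<in> carrier G \<Longrightarrow> w \<otimes> (w \<otimes> (w \<otimes> y)) = y"
proof -
  have w: "w \<in> carrier G" using assms by (simp add: center_carrier)
  show 1: "w \<otimes> (w \<otimes> w) = \<one>" using center_pow3[OF assms] w by (simp add: pow3)
  show "w \<otimes> (w \<otimes> (w \<otimes> y)) = y" if y: "y \<in> carrier G"
  proof -
    have "w \<otimes> (w \<otimes> (w \<otimes> y)) = (w \<otimes> (w \<otimes> w)) \<otimes> y" using w y by (simp add: m_assoc)
    then show ?thesis using 1 y by simp
  qed
qed

text \<open>Let \<open>u = [a,x]\<close>, \<open>v = [u,x]\<close> and \<open>w = [u,a]\<close>; the last two are central. Then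
\<open>(xa)\<^sup>3 = x\<^sup>3 a^{x\<^sup>2} a^x a = x\<^sup>3 (au\<^sup>2v)(au)a\<close>, and collecting the factors \<open>a\<close> to the left
produces five factors \<open>w\<close>, three of which cancel.\<close>

lemma pow3_mult:
  assumes [simp]: "x \<in> carrier G" "a \<in> carrier G"
  shows "(x \<otimes> a) [^] (3::nat) =
    x [^] (3::nat) \<otimes> a [^] (3::nat) \<otimes> (a \<star> x) [^] (3::nat) \<otimes> (a \<star> x \<star> a) \<otimes> (a \<star> x \<star> a) \<otimes> (a \<star> x \<star> x)"
proof -
  define u v w where "u = a \<star> x" and "v = u \<star> x" and "w = u \<star> a"
  have vZ: "v \<in> center G" and wZ: "w \<in> center G"
    using engel_in_center[of a x] by (simp_all add: u_def v_def w_def)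
  have [simp]: "u \<in> carrier G" "v \<in> carrier G" "w \<in> carrier G"
    by (simp_all add: u_def v_def w_def)
  have ax: "inv x \<otimes> a \<otimes> x = a \<otimes> u" and ux: "inv x \<otimes> u \<otimes> x = u \<otimes> v"
    by (simp_all add: u_def v_def conj_eq_mult_commutator)
  have "inv x \<otimes> (a \<otimes> u) \<otimes> x = (inv x \<otimes> a \<otimes> x) \<otimes> (inv x \<otimes> u \<otimes> x)"
    by (simp add: m_assoc cancel_left_inv)
  then have axx: "inv x \<otimes> (a \<otimes> u) \<otimes> x = a \<otimes> u \<otimes> (u \<otimes> v)"
    by (simp add: ax ux)
  have "(x \<otimes> a) [^] (3::nat) =
      x [^] (3::nat) \<otimes> ((inv x \<otimes> (inv x \<otimes> a \<otimes> x) \<otimes> x) \<otimes> (inv x \<otimes> a \<otimes> x) \<otimes> a)"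
    by (simp add: word_simps pow3)
  also have "\<dots> = x [^] (3::nat) \<otimes> (a \<otimes> u \<otimes> (u \<otimes> v) \<otimes> (a \<otimes> u) \<otimes> a)"
    by (simp only: ax axx)
  also have "a \<otimes> u \<otimes> (u \<otimes> v) \<otimes> (a \<otimes> u) \<otimes> a = a [^] (3::nat) \<otimes> (u [^] (3::nat) \<otimes> (w \<otimes> (w \<otimes> v)))"
  proof -
    have ua: "u \<otimes> a = a \<otimes> (u \<otimes> w)" by (simp add: w_def word_simps)
    have ua': "u \<otimes> (a \<otimes> y) = a \<otimes> (u \<otimes> (w \<otimes> y))" if "y \<in> carrier G" for y
    proof -
      have "u \<otimes> (a \<otimes> y) = (u \<otimes> a) \<otimes> y" using that by (simp add: m_assoc)
      then show ?thesis using that by (simp add: ua m_assoc)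
    qed
    note com = center_commute[OF wZ, of a] center_commute[OF wZ, of u]
      center_commute[OF vZ, of a] center_commute[OF vZ, of u] center_commute[OF vZ, of w]
      center_left_commute[OF wZ, of a] center_left_commute[OF wZ, of u]
      center_left_commute[OF vZ, of a] center_left_commute[OF vZ, of u] center_left_commute[OF vZ, of w]
    \<comment> \<open>The rules move \<open>a\<close> to the left past \<open>u\<close>, and the central elements to the right.\<close>
    show ?thesis
      by (simp add: m_assoc pow3 ua ua' com center_order_three[OF wZ])
  qed
  finally show ?thesis by (simp add: m_assoc u_def v_def w_def)
qed

lemma commutator_mult_right_central:
  assumes "a \<star> x \<star> y = \<one>" "a \<in> carrier G" "x \<in> carrier G" "y \<in> carrier G"
  shows "a \<star> (x \<otimes> y) = (a \<star> y) \<otimes> (a \<star> x)"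
  using assms by (simp add: commutator_mult_right)

text \<open>For \<open>d = [p,q,x]\<close> the map \<open>y \<mapsto> [d,y]\<close> is a homomorphism into the center, and a homomorphism into an
abelian group is trivial on commutators.\<close>

lemma commutator_third_commutator:
  assumes [simp]: "p \<in> carrier G" "q \<in> carrier G" "x \<in> carrier G"
  shows "p \<star> q \<star> x \<star> (p \<star> q) = \<one>"
proof -
  define c d where "c = p \<star> q" and "d = c \<star> x"
  have [simp]: "c \<in> carrier G" "d \<in> carrier G" by (simp_all add: c_def d_def)
  have dZ: "d \<star> y \<in> center G" if "y \<in> carrier G" for y
    using that by (simp add: commutator4_in_center c_def d_def)
  have hom: "d \<star> (y \<otimes> z) = (d \<star> z) \<otimes> (d \<star> y)" if "y \<in> carrier G" "z \<in> carrier G" for y z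
    using that dZ by (intro commutator_mult_right_central commutator_center) simp_all
  have "p \<otimes> q = q \<otimes> p \<otimes> c" by (simp add: c_def word_simps)
  then have "d \<star> (p \<otimes> q) = d \<star> (q \<otimes> p \<otimes> c)" by simp
  then have "(d \<star> q) \<otimes> (d \<star> p) = (d \<star> c) \<otimes> ((d \<star> p) \<otimes> (d \<star> q))"
    by (simp add: hom)
  also have "(d \<star> p) \<otimes> (d \<star> q) = (d \<star> q) \<otimes> (d \<star> p)"
    by (rule center_commute) (simp_all add: dZ)
  finally have "d \<star> c = \<one>" by simp
  then show ?thesis by (simp add: c_def d_def)
qed

text \<open>In the formula for \<open>(xc)\<^sup>3\<close> the factor \<open>[c,x,c]\<close> is trivial by the previous lemma. So is
\<open>d\<^sup>3\<close> for \<open>d = [c,x]\<close>: since \<open>cd\<close> is a conjugate of \<open>c\<close> and cubes are central,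
\<open>c\<^sup>3 = (cd)\<^sup>3 = c\<^sup>3d\<^sup>3\<close>.\<close>

lemma pow3_mult_commutator:
  assumes [simp]: "p \<in> carrier G" "q \<in> carrier G" "x \<in> carrier G"
  defines "c \<equiv> p \<star> q"
  shows "(x \<otimes> c) [^] (3::nat) = x [^] (3::nat) \<otimes> (c [^] (3::nat) \<otimes> (c \<star> x \<star> x))"
proof -
  define d where "d = c \<star> x"
  have [simp]: "c \<in> carrier G" "d \<in> carrier G" by (simp_all add: c_def d_def)
  have dc: "d \<star> c = \<one>"
    using commutator_third_commutator[of p q x] by (simp add: c_def d_def)
  then have com: "commuting d c" by (simp add: commutator_eq_one_iff commuting_def)
  have "c [^] (3::nat) \<otimes> d [^] (3::nat) = (c \<otimes> d) [^] (3::nat)"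
    using pow_mult_distrib[of c d 3] com by (simp add: commuting_def)
  also have "c \<otimes> d = inv x \<otimes> c \<otimes> x" by (simp add: d_def conj_eq_mult_commutator)
  also have "(inv x \<otimes> c \<otimes> x) [^] (3::nat) = inv x \<otimes> c [^] (3::nat) \<otimes> x"
    by (simp add: pow3 m_assoc cancel_left_inv)
  also have "\<dots> = c [^] (3::nat)" by (rule conj_center) (simp_all add: pow3_in_center)
  finally have "d [^] (3::nat) = \<one>"
    using left_cancel[of "c [^] (3::nat)" "d [^] (3::nat)" \<one>] by simp
  then show ?thesis
    using pow3_mult[of x c] dc by (simp add: m_assoc flip: d_def)
qed

end

locale central_cubes_many = central_cubes_group +
  assumes many: many_cube_roots
begin

lemma fin [simp]: "finite (carrier G)" and many_roots: "7 * order G < 9 * card cube_roots"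
  using many by (simp_all add: many_cube_roots_def)

lemma at_most_one_cube_root_shift:
  assumes "k \<in> carrier G" "t \<in> center G" "t \<noteq> \<one>"
  shows "\<not> (k = \<one> \<and> k \<otimes> t = \<one>)" "\<not> (k = \<one> \<and> k \<otimes> inv t = \<one>)"
    "\<not> (k \<otimes> t = \<one> \<and> k \<otimes> inv t = \<one>)"
proof -
  have [simp]: "t \<in> carrier G" using assms by (simp add: center_carrier)
  show "\<not> (k = \<one> \<and> k \<otimes> t = \<one>)" "\<not> (k = \<one> \<and> k \<otimes> inv t = \<one>)"
    using assms by auto
  show "\<not> (k \<otimes> t = \<one> \<and> k \<otimes> inv t = \<one>)"
  proof
    assume "k \<otimes> t = \<one> \<and> k \<otimes> inv t = \<one>"
    then have "t = inv t" using left_cancel[of k t "inv t"] assms by simp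
    then have "t \<otimes> t = \<one>" by (metis \<open>t \<in> carrier G\<close> r_inv)
    then show False using center_order_three(1)[of t] assms by simp
  qed
qed

text \<open>For a commutator \<open>c\<close>, this is the factor by which the cube of \<open>x\<close> changes when \<open>x\<close> is multiplied by
\<open>c\<close>; as a function of \<open>x\<close> it is a constant times a quadratic form.\<close>

definition cube_factor :: "'a \<Rightarrow> 'a \<Rightarrow> 'a" where
  "cube_factor c x = c [^] (3::nat) \<otimes> (c \<star> x \<star> x)"

text \<open>The cubes of \<open>x\<close>, \<open>xc\<close> and \<open>xc\<^sup>-\<^sup>1\<close> are \<open>k\<close>, \<open>kt\<close> and \<open>kt\<^sup>-\<^sup>1\<close> with \<open>t = cube_factor c x\<close>. If
\<open>t \<noteq> 1\<close>, these are three different elements, and at least two of \<open>x\<close>, \<open>xc\<close>, \<open>xc\<^sup>-\<^sup>1\<close> are among the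
less than \<open>2/9\<close> of the elements with nontrivial cube.\<close>

lemma cube_factor_nontrivial_rare:
  assumes [simp]: "p \<in> carrier G" "q \<in> carrier G"
  defines "c \<equiv> p \<star> q"
  shows "3 * card {x \<in> carrier G. cube_factor c x \<noteq> \<one>} < order G"
proof -
  have [simp]: "c \<in> carrier G" by (simp add: c_def)
  have tZ: "cube_factor c x \<in> center G" if "x \<in> carrier G" for x
    using that by (simp add: cube_factor_def center_mult pow3_in_center commutator4_in_center c_def)
  have tc [simp]: "cube_factor c x \<in> carrier G" if "x \<in> carrier G" for x
    using that by (simp add: cube_factor_def)
  have plus: "(x \<otimes> c) [^] (3::nat) = x [^] (3::nat) \<otimes> cube_factor c x" if "x \<in> carrier G" for x
    using that pow3_mult_commutator[of p q x] by (simp add: cube_factor_def c_def)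
  have minus: "(x \<otimes> inv c) [^] (3::nat) = x [^] (3::nat) \<otimes> inv (cube_factor c x)"
    if [simp]: "x \<in> carrier G" for x
  proof -
    have "commuting (c \<star> x) c"
      using commutator_third_commutator[of p q x] by (simp add: c_def commutator_eq_one_iff commuting_def)
    then have "commuting (c \<star> x) (inv c)" by (intro commuting_inv) simp_all
    then have 1: "c \<star> x \<star> inv c = \<one>" by (simp add: commutator_eq_one_iff commuting_def)
    moreover have "c \<star> inv c = \<one>" by (simp add: commutator_eq_one_iff)
    ultimately have 2: "c \<star> (x \<otimes> inv c) = c \<star> x" by (simp add: commutator_mult_right)
    have "c \<star> x \<star> (x \<otimes> inv c) = (c \<star> x \<star> inv c) \<otimes> (c \<star> x \<star> x)"
      by (rule commutator_mult_right_central)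
        (simp_all add: commutator_center commutator4_in_center c_def)
    then have "cube_factor c (x \<otimes> inv c) = cube_factor c x" by (simp add: cube_factor_def 1 2)
    then have "x [^] (3::nat) = (x \<otimes> inv c) [^] (3::nat) \<otimes> cube_factor c x"
      using plus[of "x \<otimes> inv c"] by (simp add: m_assoc)
    then show ?thesis by (simp add: inv_solve_right)
  qed
  let ?W = "{x \<in> carrier G. cube_factor c x \<noteq> \<one>}"
  have "2 * card ?W \<le> 3 * card (carrier G - cube_roots)"
  proof (rule card_le_translates[where a = c])
    fix x assume "x \<in> ?W"
    then have [simp]: "x \<in> carrier G" and t: "cube_factor c x \<noteq> \<one>" by auto
    define k t where "k = x [^] (3::nat)" and "t = cube_factor c x"
    have [simp]: "k \<in> carrier G" "t \<in> carrier G" by (simp_all add: k_def t_def)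
    have "t \<noteq> \<one>" using \<open>cube_factor c x \<noteq> \<one>\<close> by (simp add: t_def)
    have "t \<in> center G" by (simp add: t_def tZ)
    from at_most_one_cube_root_shift[OF \<open>k \<in> carrier G\<close> this \<open>t \<noteq> \<one>\<close>]
    show "2 \<le> translates_in (carrier G - cube_roots) c x"
      by (auto simp: cube_roots_def plus minus k_def t_def of_bool_def)
  qed auto
  moreover have "card (carrier G - cube_roots) = order G - card cube_roots"
    unfolding order_def by (intro card_Diff_subset) (auto simp: cube_roots_def intro: finite_subset[OF _ fin])
  moreover have "card cube_roots \<le> order G"
    unfolding order_def by (intro card_mono) (auto simp: cube_roots_def)
  ultimately show ?thesis using many_roots by linarith
qed

lemma commutator_right_additive:
  assumes [simp]: "p \<in> carrier G" "q \<in> carrier G" "x \<in> carrier G" "y \<in> carrier G" "z \<in> carrier G"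
  defines "c \<equiv> p \<star> q"
  shows "c \<star> x \<star> (y \<otimes> z) = (c \<star> x \<star> y) \<otimes> (c \<star> x \<star> z)"
proof -
  have "c \<star> x \<star> (y \<otimes> z) = (c \<star> x \<star> z) \<otimes> (c \<star> x \<star> y)"
    by (rule commutator_mult_right_central)
      (simp_all add: commutator_center commutator4_in_center c_def)
  then show ?thesis by (simp add: center_commute commutator4_in_center c_def)
qed

lemma commutator_middle_additive:
  assumes [simp]: "p \<in> carrier G" "q \<in> carrier G" "x \<in> carrier G" "y \<in> carrier G" "z \<in> carrier G"
  defines "c \<equiv> p \<star> q"
  shows "c \<star> (x \<otimes> y) \<star> z = (c \<star> x \<star> z) \<otimes> (c \<star> y \<star> z)"
proof -
  have [simp]: "c \<in> carrier G" by (simp add: c_def)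
  have Z: "c \<star> u \<star> v \<in> center G" if "u \<in> carrier G" "v \<in> carrier G" for u v
    using that by (simp add: commutator4_in_center c_def)
  have "(c \<star> y) \<star> z \<in> center G" "(c \<star> x) \<star> z \<in> center G" by (simp_all add: Z)
  have "c \<star> (x \<otimes> y) = (c \<star> y) \<otimes> ((c \<star> x) \<otimes> (c \<star> x \<star> y))"
    by (simp add: commutator_mult_right m_assoc)
  moreover have "((c \<star> y) \<otimes> ((c \<star> x) \<otimes> (c \<star> x \<star> y))) \<star> z =
      (c \<star> y \<star> z) \<otimes> (((c \<star> x) \<otimes> (c \<star> x \<star> y)) \<star> z)"
    by (rule commutator_mult_left_central) (simp_all add: Z)
  moreover have "((c \<star> x) \<otimes> (c \<star> x \<star> y)) \<star> z = (c \<star> x \<star> z) \<otimes> (c \<star> x \<star> y \<star> z)"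
    by (rule commutator_mult_left_central) (simp_all add: Z)
  moreover have "c \<star> x \<star> y \<star> z = \<one>" by (simp add: commutator_center Z)
  ultimately show ?thesis by (simp add: center_commute Z)
qed

text \<open>Put \<open>B x y = [c,x,y]\<close> with \<open>c = [p,q]\<close>, a bilinear map into the center, and let \<open>h\<close> be the cube
factor of \<open>x\<close>. The cube factors of \<open>xy\<close> and \<open>xy\<^sup>-\<^sup>1\<close> are \<open>hsb\<close> and \<open>hs\<^sup>-\<^sup>1b\<close> with \<open>s = B x y \<otimes> B y x\<close> and
\<open>b = B y y\<close>. If all three are trivial, then \<open>b\<^sup>2 = 1\<close> and so \<open>b = 1\<close>. Hence \<open>b \<noteq> 1\<close> would make the cube
factor nontrivial on at least a third of the group.\<close>

lemma commutator_two_engel: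
  assumes [simp]: "p \<in> carrier G" "q \<in> carrier G" "y \<in> carrier G"
  shows "p \<star> q \<star> y \<star> y = \<one>"
proof (rule ccontr)
  define c where "c = p \<star> q"
  define B where "B x y = c \<star> x \<star> y" for x y
  assume "p \<star> q \<star> y \<star> y \<noteq> \<one>"
  then have byy: "B y y \<noteq> \<one>" by (simp add: B_def c_def)
  have [simp]: "c \<in> carrier G" by (simp add: c_def)
  have BZ: "B u v \<in> center G" if "u \<in> carrier G" "v \<in> carrier G" for u v
    using that by (simp add: commutator4_in_center B_def c_def)
  have [simp]: "B u v \<in> carrier G" if "u \<in> carrier G" "v \<in> carrier G" for u v
    using that by (simp add: B_def)
  have B_right: "B u (v \<otimes> w) = B u v \<otimes> B u w"
    if "u \<in> carrier G" "v \<in> carrier G" "w \<in> carrier G" for u v w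
    using that by (simp add: B_def c_def commutator_right_additive)
  have B_left: "B (u \<otimes> v) w = B u w \<otimes> B v w"
    if "u \<in> carrier G" "v \<in> carrier G" "w \<in> carrier G" for u v w
    using that by (simp add: B_def c_def commutator_middle_additive)
  have B_one: "B u \<one> = \<one>" "B \<one> u = \<one>" if "u \<in> carrier G" for u
    using that by (simp_all add: B_def commutator_def)
  have B_inv: "B u (inv v) = inv (B u v)" "B (inv v) u = inv (B v u)"
    if "u \<in> carrier G" "v \<in> carrier G" for u v
  proof -
    have "B u (inv v) \<otimes> B u v = \<one>"
      using that B_right[of u "inv v" v, symmetric] by (simp add: B_one)
    moreover have "B (inv v) u \<otimes> B v u = \<one>"
      using that B_left[of "inv v" v u, symmetric] by (simp add: B_one)
    ultimately show "B u (inv v) = inv (B u v)" "B (inv v) u = inv (B v u)"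
      using that by (simp_all add: inv_equality)
  qed
  let ?W = "{x \<in> carrier G. cube_factor c x \<noteq> \<one>}"
  have "1 * card (carrier G) \<le> 3 * card ?W"
  proof (rule card_le_translates[where a = y])
    fix x assume [simp]: "x \<in> carrier G"
    define h s b where "h = cube_factor c x" and "s = B x y \<otimes> B y x" and "b = B y y"
    have [simp]: "h \<in> carrier G" "s \<in> carrier G" "b \<in> carrier G"
      by (simp_all add: h_def s_def b_def cube_factor_def)
    have bZ: "b \<in> center G" by (simp add: b_def BZ)
    have plus: "cube_factor c (x \<otimes> y) = h \<otimes> (s \<otimes> b)"
      using center_left_commute[OF BZ[of x y], of "B y x" "B y y"]
      by (simp add: cube_factor_def h_def s_def b_def B_left B_right m_assoc flip: B_def)
    have minus: "cube_factor c (x \<otimes> inv y) = h \<otimes> (inv s \<otimes> b)"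
      using center_commute[OF center_inv[OF BZ[of x y]], of "inv (B y x)"]
        center_commute[OF BZ[of y y], of "inv (B x y)"]
      by (simp add: cube_factor_def h_def s_def b_def B_left B_right B_inv m_assoc inv_mult_group flip: B_def)
    have "\<not> (h = \<one> \<and> h \<otimes> (s \<otimes> b) = \<one> \<and> h \<otimes> (inv s \<otimes> b) = \<one>)"
    proof (rule notI, elim conjE)
      assume h: "h = \<one>" and 1: "h \<otimes> (s \<otimes> b) = \<one>" and 2: "h \<otimes> (inv s \<otimes> b) = \<one>"
      have "b \<otimes> b = (s \<otimes> b) \<otimes> (inv s \<otimes> b)"
        using center_left_commute[OF bZ, of "inv s" b] by (simp add: m_assoc cancel_left_inv)
      then have "b \<otimes> b = \<one>" using h 1 2 by simp
      then have "b = \<one>" using center_order_three(1)[OF bZ] by simp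
      then show False using byy by (simp add: b_def)
    qed
    then show "1 \<le> translates_in ?W y x"
      using plus minus by (auto simp: of_bool_def h_def)
  qed auto
  then show False
    using cube_factor_nontrivial_rare[of p q] by (simp add: order_def c_def)
qed

lemma commutator_pow3_trivial:
  assumes [simp]: "p \<in> carrier G" "q \<in> carrier G"
  shows "(p \<star> q) [^] (3::nat) = \<one>"
proof (rule ccontr)
  assume "(p \<star> q) [^] (3::nat) \<noteq> \<one>"
  then have "{x \<in> carrier G. cube_factor (p \<star> q) x \<noteq> \<one>} = carrier G"
    by (auto simp: cube_factor_def commutator_two_engel)
  then show False
    using cube_factor_nontrivial_rare[of p q] by (simp add: order_def)
qed

text \<open>A bilinear map that vanishes on the diagonal is antisymmetric.\<close>

lemma commutator_alternating:
  assumes [simp]: "p \<in> carrier G" "q \<in> carrier G" "x \<in> carrier G" "y \<in> carrier G"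
  shows "p \<star> q \<star> y \<star> x = inv (p \<star> q \<star> x \<star> y)"
proof -
  have "p \<star> q \<star> (y \<otimes> x) \<star> (y \<otimes> x) =
      (p \<star> q \<star> y \<star> (y \<otimes> x)) \<otimes> (p \<star> q \<star> x \<star> (y \<otimes> x))"
    by (rule commutator_middle_additive) simp_all
  also have "p \<star> q \<star> y \<star> (y \<otimes> x) = p \<star> q \<star> y \<star> x"
    by (subst commutator_right_additive) (simp_all add: commutator_two_engel)
  also have "p \<star> q \<star> x \<star> (y \<otimes> x) = p \<star> q \<star> x \<star> y"
    by (subst commutator_right_additive) (simp_all add: commutator_two_engel)
  finally have "(p \<star> q \<star> y \<star> x) \<otimes> (p \<star> q \<star> x \<star> y) = \<one>"
    by (simp add: commutator_two_engel)
  then show ?thesis by (simp add: inv_equality)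
qed

text \<open>The deviation of \<open>g y = [a,y,a]\<close> from being a homomorphism is \<open>[a,y,z,a] = [a,y,a,z]\<^sup>-\<^sup>1\<close>, which is
trivial because \<open>[a,y,a]\<close> is central. The kernel of \<open>g\<close> contains more than a third of the group, by
the lemmas \<open>card_three_cube_roots\<close> and \<open>commuting_conj_if_cubes_trivial\<close>. A nontrivial
homomorphism into a group of exponent 3 has a kernel of index at least 3.\<close>

lemma two_engel:
  assumes [simp]: "a \<in> carrier G" "x \<in> carrier G"
  shows "a \<star> x \<star> a = \<one>"
proof (rule ccontr)
  assume x0: "a \<star> x \<star> a \<noteq> \<one>"
  define g where "g y = a \<star> y \<star> a" for y
  have gZ: "g y \<in> center G" if "y \<in> carrier G" for y
    using that by (simp add: g_def engel_in_center)
  have [simp]: "g y \<in> carrier G" if "y \<in> carrier G" for y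
    using that by (simp add: g_def)
  have g_mult: "g (y \<otimes> z) = g y \<otimes> g z" if [simp]: "y \<in> carrier G" "z \<in> carrier G" for y z
  proof -
    define d where "d = a \<star> y \<star> z"
    have [simp]: "d \<in> carrier G" by (simp add: d_def)
    have "d \<star> a = inv (a \<star> y \<star> a \<star> z)" unfolding d_def by (rule commutator_alternating) simp_all
    also have "a \<star> y \<star> a \<star> z = \<one>" by (simp add: commutator_center engel_in_center)
    finally have da: "d \<star> a = \<one>" by simp
    have "a \<star> (y \<otimes> z) = (a \<star> z) \<otimes> ((a \<star> y) \<otimes> d)"
      by (simp add: commutator_mult_right d_def m_assoc)
    moreover have "((a \<star> z) \<otimes> ((a \<star> y) \<otimes> d)) \<star> a = g z \<otimes> (((a \<star> y) \<otimes> d) \<star> a)"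
      unfolding g_def by (rule commutator_mult_left_central) (simp_all add: engel_in_center)
    moreover have "((a \<star> y) \<otimes> d) \<star> a = g y \<otimes> (d \<star> a)"
      unfolding g_def by (rule commutator_mult_left_central) (simp_all add: engel_in_center)
    ultimately have "g (y \<otimes> z) = g z \<otimes> g y" by (simp add: g_def da)
    then show ?thesis by (simp add: center_commute[OF gZ[of z], of "g y"])
  qed
  have g_inv: "g (y \<otimes> inv z) = g y \<otimes> inv (g z)" if "y \<in> carrier G" "z \<in> carrier G" for y z
    using that g_mult[of "y \<otimes> inv z" z] by (simp add: m_assoc inv_solve_right)
  define K where "K = {y \<in> carrier G. g y = \<one>}"
  let ?T = "{y \<in> carrier G. y \<in> cube_roots \<and> y \<otimes> a \<in> cube_roots \<and> y \<otimes> inv a \<in> cube_roots}"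
  have "?T \<subseteq> K"
  proof
    fix y assume "y \<in> ?T"
    then have [simp]: "y \<in> carrier G" and "commuting a (inv y \<otimes> a \<otimes> y)"
      by (auto simp: cube_roots_def intro!: commuting_conj_if_cubes_trivial)
    then have "commuting a (inv a \<otimes> (inv y \<otimes> a \<otimes> y))"
      by (rule_tac commuting_mult[OF commuting_inv]) (simp_all add: commuting_def)
    moreover have "inv a \<otimes> (inv y \<otimes> a \<otimes> y) = a \<star> y" by (simp add: word_simps)
    ultimately show "y \<in> K"
      by (simp add: K_def g_def commutator_eq_one_iff commuting_def)
  qed
  then have "card ?T \<le> card K" by (intro card_mono) (auto simp: K_def)
  moreover have "order G < 3 * card ?T"
    by (rule card_three_cube_roots[OF many]) simp
  moreover have "3 * card K \<le> 1 * order G"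
  proof (rule translates_le_card[where a = x])
    fix y assume [simp]: "y \<in> carrier G"
    define k t where "k = g y" and "t = g x"
    have [simp]: "k \<in> carrier G" "t \<in> carrier G" by (simp_all add: k_def t_def)
    have tZ: "t \<in> center G" by (simp add: t_def gZ)
    have t1: "t \<noteq> \<one>" using x0 by (simp add: t_def g_def)
    show "translates_in K x y \<le> 1"
      using at_most_one_cube_root_shift[OF \<open>k \<in> carrier G\<close> tZ t1]
      by (auto simp: K_def g_mult[of y x] g_inv of_bool_def k_def t_def)
  qed (auto simp: K_def)
  ultimately show False by linarith
qed

text \<open>All commutator terms in lemma \<open>pow3_mult\<close> are now known to be trivial, so cubing is a homomorphism
into the center. Its kernel, the set of cube roots of one, contains more than a third of the group.\<close>

theorem exponent_three:
  assumes [simp]: "a \<in> carrier G"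
  shows "a [^] (3::nat) = \<one>"
proof (rule ccontr)
  assume a3: "a [^] (3::nat) \<noteq> \<one>"
  define f where "f = a [^] (3::nat)"
  have fZ: "f \<in> center G" and [simp]: "f \<in> carrier G" by (simp_all add: f_def pow3_in_center)
  have plus: "(x \<otimes> b) [^] (3::nat) = x [^] (3::nat) \<otimes> b [^] (3::nat)"
    if [simp]: "x \<in> carrier G" "b \<in> carrier G" for x b
  proof -
    have "commuting x (inv (x \<star> b))"
      using two_engel[of x b] by (intro commuting_inv) (simp_all add: commutator_eq_one_iff commuting_def)
    then have "b \<star> x \<star> x = \<one>"
      by (simp add: inv_commutator commutator_eq_one_iff commuting_def)
    then show ?thesis
      by (simp add: pow3_mult two_engel commutator_pow3_trivial)
  qed
  have minus: "(x \<otimes> inv a) [^] (3::nat) = x [^] (3::nat) \<otimes> inv f" if "x \<in> carrier G" for x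
  proof -
    have "x [^] (3::nat) = (x \<otimes> inv a) [^] (3::nat) \<otimes> f"
      using plus[of "x \<otimes> inv a" a] that by (simp add: m_assoc f_def)
    then show ?thesis using that by (simp add: inv_solve_right)
  qed
  have "3 * card cube_roots \<le> 1 * order G"
  proof (rule translates_le_card[where a = a])
    fix x assume [simp]: "x \<in> carrier G"
    define k where "k = x [^] (3::nat)"
    have "k \<in> carrier G" by (simp add: k_def)
    then show "translates_in cube_roots a x \<le> 1"
      using at_most_one_cube_root_shift[of k f] a3 fZ
      by (auto simp: cube_roots_def plus[of x a] minus of_bool_def k_def simp flip: f_def)
  qed (auto simp: cube_roots_def)
  then show False using many_roots by linarith
qed

end

section \<open>Fixed points of p-groups\<close>

text \<open>The sizes of the orbits are powers of \<open>p\<close>, and the orbits of size 1 are the fixed points.\<close>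

lemma (in group_action) fixed_points_cong:
  assumes p: "prime p" and order: "order G = p ^ k" and fin: "finite E"
  shows "card {x \<in> E. \<forall>g \<in> carrier G. \<phi> g x = x} mod p = card E mod p"
proof -
  interpret group G using group_hom by (rule group_hom.axioms(1))
  define F where "F = {x \<in> E. \<forall>g \<in> carrier G. \<phi> g x = x}"
  have orb: "card orb mod p = (\<Sum>x\<in>orb. of_bool (x \<in> F)) mod p" if orb_mem: "orb \<in> orbits G E \<phi>" for orb
  proof -
    obtain x where x: "x \<in> E" "orb = orbit G \<phi> x"
      using orb_mem by (auto simp: orbits_def)
    show ?thesis
    proof (cases "orb \<inter> F = {}")
      case True
      have "card orb dvd p ^ k"
        using orbit_stabilizer_theorem[OF x(1)] order x(2) by (metis dvd_triv_left)
      moreover have "card orb \<noteq> 1"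
      proof
        assume "card orb = 1"
        then obtain y where y: "orb = {y}" by (rule card_1_singletonE)
        then have "y = x" using orbit_refl[OF x(1)] x(2) by simp
        then have "x \<in> F" using x y by (auto simp: F_def orbit_def)
        then show False using True y \<open>y = x\<close> by simp
      qed
      ultimately have "p dvd card orb"
        using p by (auto simp: divides_primepow_nat dest!: gr0_conv_Suc[THEN iffD1] intro: Nat.gr0I)
      moreover have "(\<Sum>x\<in>orb. of_bool (x \<in> F)) = (0::nat)"
        using True by (intro sum.neutral) auto
      ultimately show ?thesis by simp
    next
      case False
      then obtain y where y: "y \<in> orb" "y \<in> F" by blast
      then have "x \<in> orbit G \<phi> y" using x by (auto simp: F_def intro: orbit_sym)
      then have "x = y" using y by (auto simp: F_def orbit_def)
      then have "orb = {y}" using x(2) y orbit_refl[OF x(1)] by (auto simp: F_def orbit_def)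
      then show ?thesis using y by simp
    qed
  qed
  have "finite (orbits G E \<phi>)"
    using fin orbits_coverture by (metis finite_UnionD)
  have "card E = (\<Sum>orb\<in>orbits G E \<phi>. card orb)"
    using disjoint_sum[OF fin, of "\<lambda>_. 1::nat"] by simp
  then have "card E mod p = (\<Sum>orb\<in>orbits G E \<phi>. card orb mod p) mod p"
    by (simp add: mod_sum_eq)
  also have "\<dots> = (\<Sum>orb\<in>orbits G E \<phi>. (\<Sum>x\<in>orb. of_bool (x \<in> F)) mod p) mod p"
    using orb by simp
  also have "\<dots> = (\<Sum>orb\<in>orbits G E \<phi>. \<Sum>x\<in>orb. of_bool (x \<in> F)) mod p"
    by (simp add: mod_sum_eq)
  also have "\<dots> = (\<Sum>x\<in>E. of_bool (x \<in> F)) mod p"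
    by (simp only: disjoint_sum[OF fin])
  also have "(\<Sum>x\<in>E. of_bool (x \<in> F)) = card F"
    using fin by (simp add: F_def Int_def)
  finally show ?thesis by (simp add: F_def)
qed

context group
begin

lemma card_Union_rcosets:
  assumes fin: "finite (carrier G)" and P: "subgroup P G" and F: "F \<subseteq> rcosets P"
  shows "card (\<Union>F) = card P * card F"
proof -
  have finR: "finite (rcosets P)"
    using fin rcosets_part_G[OF P] by (metis finite_UnionD)
  have "card P * card F = card (\<Union>F)"
  proof (rule card_partition)
    show "finite F" using finR F by (rule finite_subset[rotated])
    have "\<Union>F \<subseteq> carrier G" using F rcosets_part_G[OF P] by blast
    then show "finite (\<Union>F)" using fin by (rule finite_subset)
    show "card c = card P" if "c \<in> F" for c
      using that F card_rcosets_equal[OF _ subgroup.subset[OF P], of c, symmetric] by blast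
    show "c1 \<inter> c2 = {}" if "c1 \<in> F" "c2 \<in> F" "c1 \<noteq> c2" for c1 c2
      using that F rcos_disjoint[OF P] by (auto simp: pairwise_def disjnt_def)
  qed
  then show ?thesis by simp
qed

lemma right_coset_action:
  assumes P: "subgroup P G" and H: "subgroup H G"
  shows "group_action (G\<lparr>carrier := H\<rparr>) (rcosets P) (\<lambda>h. \<lambda>C\<in>rcosets P. C #> inv h)"
proof -
  let ?\<phi> = "\<lambda>h. \<lambda>C\<in>rcosets P. C #> inv h"
  have PG: "P \<subseteq> carrier G" using P by (rule subgroup.subset)
  have closed: "C #> g \<in> rcosets P" if "C \<in> rcosets P" "g \<in> carrier G" for C g
    using that PG by (auto simp: RCOSETS_def coset_mult_assoc)
  have assoc: "C #> g #> h = C #> (g \<otimes> h)"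
    if "C \<in> rcosets P" "g \<in> carrier G" "h \<in> carrier G" for C g h
    using that rcosets_subset_PowG[OF P] by (intro coset_mult_assoc) auto
  have one: "C #> \<one> = C" if "C \<in> rcosets P" for C
    using that rcosets_subset_PowG[OF P] by (intro coset_mult_one) auto
  have Hc: "h \<in> carrier G" if "h \<in> H" for h using subgroup.subset[OF H] that by blast
  have bij: "?\<phi> h \<in> Bij (rcosets P)" if "h \<in> carrier G" for h
  proof -
    have "bij_betw (\<lambda>C. C #> inv h) (rcosets P) (rcosets P)"
      by (rule bij_betwI[where g = "\<lambda>C. C #> h"]) (use that in \<open>auto simp: closed assoc one\<close>)
    then show ?thesis by (simp add: Bij_def bij_betw_restrict_eq)
  qed
  have "?\<phi> \<in> hom (G\<lparr>carrier := H\<rparr>) (BijGroup (rcosets P))"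
  proof (rule homI)
    fix h assume "h \<in> carrier (G\<lparr>carrier := H\<rparr>)"
    then show "?\<phi> h \<in> carrier (BijGroup (rcosets P))"
      using bij Hc by (simp add: BijGroup_def)
  next
    fix g h assume "g \<in> carrier (G\<lparr>carrier := H\<rparr>)" "h \<in> carrier (G\<lparr>carrier := H\<rparr>)"
    then have [simp]: "g \<in> carrier G" "h \<in> carrier G" using Hc by auto
    have "?\<phi> (g \<otimes> h) = compose (rcosets P) (?\<phi> g) (?\<phi> h)"
      by (auto simp: compose_def closed assoc inv_mult_group fun_eq_iff)
    then show "?\<phi> (g \<otimes>\<^bsub>G\<lparr>carrier := H\<rparr>\<^esub> h) = ?\<phi> g \<otimes>\<^bsub>BijGroup (rcosets P)\<^esub> ?\<phi> h"
      using bij by (simp add: BijGroup_def)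
  qed
  then show ?thesis
    using subgroup_imp_group[OF H] group_BijGroup[of "rcosets P"]
    by (simp add: group_action_def group_hom_def group_hom_axioms_def)
qed

lemma rcoset_fixed_iff:
  assumes P: "subgroup P G" and g: "g \<in> carrier G" and h: "h \<in> carrier G"
  shows "P #> g #> inv h = P #> g \<longleftrightarrow> g \<otimes> h \<otimes> inv g \<in> P"
proof -
  have PG: "P \<subseteq> carrier G" using P by (rule subgroup.subset)
  have "P #> g #> inv h = P #> (g \<otimes> inv h)" using PG g h by (simp add: coset_mult_assoc)
  then have "P #> g #> inv h = P #> g \<longleftrightarrow> g \<in> P #> (g \<otimes> inv h)"
    using rcos_self[OF g P] repr_independence[OF _ _ P, of g "g \<otimes> inv h"] g h by auto
  also have "\<dots> \<longleftrightarrow> g \<otimes> inv (g \<otimes> inv h) \<in> P"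
    using subgroup.rcos_module[OF P is_group] g h by simp
  also have "g \<otimes> inv (g \<otimes> inv h) = g \<otimes> h \<otimes> inv g"
    using g h by (simp add: inv_mult_group m_assoc)
  finally show ?thesis .
qed

text \<open>The group \<open>H\<close> acts on the right cosets of \<open>P\<close>. The coset \<open>Pg\<close> is fixed exactly if \<open>gHg\<^sup>-\<^sup>1 \<subseteq> P\<close>, so
\<open>f\<close> is the number of fixed cosets.\<close>

lemma card_conjugators_into:
  assumes fin: "finite (carrier G)" and P: "subgroup P G" and H: "subgroup H G"
    and p: "prime p" and card_H: "card H = p ^ k"
  obtains f where "card {g \<in> carrier G. \<forall>h \<in> H. g \<otimes> h \<otimes> inv g \<in> P} = card P * f"
    and "f mod p = card (rcosets P) mod p"
proof -
  interpret act: group_action "G\<lparr>carrier := H\<rparr>" "rcosets P" "\<lambda>h. \<lambda>C\<in>rcosets P. C #> inv h"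
    using P H by (rule right_coset_action)
  define F where "F = {C \<in> rcosets P. \<forall>h \<in> H. C #> inv h = C}"
  have finR: "finite (rcosets P)"
    using fin rcosets_part_G[OF P] by (metis finite_UnionD)
  have "F = {x \<in> rcosets P. \<forall>g\<in>carrier (G\<lparr>carrier := H\<rparr>). (\<lambda>C\<in>rcosets P. C #> inv g) x = x}"
    by (auto simp: F_def)
  then have "card F mod p = card (rcosets P) mod p"
    using act.fixed_points_cong[OF p _ finR, of k] card_H by (simp add: order_def)
  moreover have "card {g \<in> carrier G. \<forall>h \<in> H. g \<otimes> h \<otimes> inv g \<in> P} = card P * card F"
  proof -
    have PG: "P \<subseteq> carrier G" using P by (rule subgroup.subset)
    have H_carrier: "h \<in> carrier G" if "h \<in> H" for h using subgroup.subset[OF H] that by blast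
    have mem: "g \<in> \<Union>F \<longleftrightarrow> g \<in> carrier G \<and> (\<forall>h \<in> H. g \<otimes> h \<otimes> inv g \<in> P)" for g
    proof
      assume "g \<in> \<Union>F"
      then obtain C where C: "C \<in> F" "g \<in> C" by blast
      then have g: "g \<in> carrier G" using rcosets_subset_PowG[OF P] by (auto simp: F_def)
      obtain a where "a \<in> carrier G" "C = P #> a" using C by (auto simp: F_def RCOSETS_def)
      then have "C = P #> g" using C(2) repr_independence[OF _ _ P] by auto
      then show "g \<in> carrier G \<and> (\<forall>h \<in> H. g \<otimes> h \<otimes> inv g \<in> P)"
        using C(1) g rcoset_fixed_iff[OF P g] H_carrier by (auto simp: F_def)
    next
      assume g: "g \<in> carrier G \<and> (\<forall>h \<in> H. g \<otimes> h \<otimes> inv g \<in> P)"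
      then have "P #> g \<in> F"
        using rcoset_fixed_iff[OF P] H_carrier rcosetsI[OF PG] by (auto simp: F_def)
      then show "g \<in> \<Union>F" using rcos_self[of g P] g P by blast
    qed
    then have "{g \<in> carrier G. \<forall>h \<in> H. g \<otimes> h \<otimes> inv g \<in> P} = \<Union>F" by blast
    moreover have "card (\<Union>F) = card P * card F"
      by (rule card_Union_rcosets[OF fin P]) (auto simp: F_def)
    ultimately show ?thesis by simp
  qed
  ultimately show thesis using that by blast
qed

lemma center_of_p_group:
  assumes "finite (carrier G)" "prime p" "order G = p ^ k" "k \<noteq> 0"
  shows "center G \<noteq> {\<one>}"
proof
  assume Z: "center G = {\<one>}"
  interpret act: group_action G "carrier G" "\<lambda>g. \<lambda>h\<in>carrier G. g \<otimes> h \<otimes> inv g"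
    by (rule action_by_conjugation)
  have "{x \<in> carrier G. \<forall>g\<in>carrier G. (\<lambda>h\<in>carrier G. g \<otimes> h \<otimes> inv g) x = x} = center G"
  proof -
    have "g \<otimes> x \<otimes> inv g = x \<longleftrightarrow> x \<otimes> g = g \<otimes> x" if "g \<in> carrier G" "x \<in> carrier G" for g x
      using that inv_solve_right'[of x "g \<otimes> x" g] by auto
    then show ?thesis by (auto simp: center_def)
  qed
  then have "card (center G) mod p = 0"
    using act.fixed_points_cong[OF assms(2,3,1)] assms(3,4) by (simp add: order_def)
  then show False using Z assms(2) by (auto dest: prime_gt_1_nat)
qed

end

section \<open>Groups with many cube roots of one are 3-groups\<close>

context group
begin

definition centralizer :: "'a \<Rightarrow> 'a set" where
  "centralizer a = {g \<in> carrier G. commuting a g}"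

lemma centralizer_subgroup:
  assumes "a \<in> carrier G"
  shows "subgroup (centralizer a) G"
proof
  show "centralizer a \<subseteq> carrier G" by (auto simp: centralizer_def)
  show "\<one> \<in> centralizer a" using assms by (simp add: centralizer_def commuting_def)
  show "x \<otimes> y \<in> centralizer a" if "x \<in> centralizer a" "y \<in> centralizer a" for x y
    using that assms by (simp add: centralizer_def commuting_mult)
  show "inv x \<in> centralizer a" if "x \<in> centralizer a" for x
    using that assms by (simp add: centralizer_def commuting_inv)
qed

text \<open>For more than a third of the elements \<open>x\<close>, the conjugate \<open>x\<^sup>-\<^sup>1ax\<close> lies in the centralizer of \<open>a\<close>,
and conjugation by \<open>g\<close> moves it on into \<open>P\<close>.\<close>

lemma card_conjugators_if_centralizer_conjugate:
  assumes many: many_cube_roots and P: "subgroup P G"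
    and a: "a \<in> carrier G" and g: "g \<in> carrier G"
    and into: "\<And>h. h \<in> centralizer a \<Longrightarrow> g \<otimes> h \<otimes> inv g \<in> P"
  shows "order G < 3 * card {y \<in> carrier G. y \<otimes> a \<otimes> inv y \<in> P}"
proof -
  have fin: "finite (carrier G)" using many by (simp add: many_cube_roots_def)
  let ?T = "{x \<in> carrier G. x \<in> cube_roots \<and> x \<otimes> a \<in> cube_roots \<and> x \<otimes> inv a \<in> cube_roots}"
  have "order G < 3 * card ?T" by (rule card_three_cube_roots[OF many a])
  also have "card ?T \<le> card {y \<in> carrier G. y \<otimes> a \<otimes> inv y \<in> P}"
  proof (rule card_inj_on_le[where f = "\<lambda>x. g \<otimes> inv x"])
    show "inj_on (\<lambda>x. g \<otimes> inv x) ?T"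
      using g by (auto simp: inj_on_def dest: inv_inj[THEN inj_onD])
    show "(\<lambda>x. g \<otimes> inv x) ` ?T \<subseteq> {y \<in> carrier G. y \<otimes> a \<otimes> inv y \<in> P}"
    proof clarify
      fix x assume [simp]: "x \<in> carrier G" and "x \<in> cube_roots" "x \<otimes> a \<in> cube_roots" "x \<otimes> inv a \<in> cube_roots"
      then have "commuting a (inv x \<otimes> a \<otimes> x)"
        using a by (intro commuting_conj_if_cubes_trivial) (auto simp: cube_roots_def)
      then have "g \<otimes> (inv x \<otimes> a \<otimes> x) \<otimes> inv g \<in> P"
        using a by (intro into) (simp add: centralizer_def)
      also have "g \<otimes> (inv x \<otimes> a \<otimes> x) \<otimes> inv g = (g \<otimes> inv x) \<otimes> a \<otimes> inv (g \<otimes> inv x)"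
        using a g by (simp add: m_assoc inv_mult_group)
      finally show "g \<otimes> inv x \<in> carrier G \<and> g \<otimes> inv x \<otimes> a \<otimes> inv (g \<otimes> inv x) \<in> P"
        using g by simp
    qed
    show "finite {y \<in> carrier G. y \<otimes> a \<otimes> inv y \<in> P}" using fin by simp
  qed
  finally show ?thesis by simp
qed

lemma sum_card_conjugators:
  assumes fin: "finite (carrier G)" and P: "P \<subseteq> carrier G"
  shows "(\<Sum>s\<in>carrier G. card {y \<in> carrier G. y \<otimes> s \<otimes> inv y \<in> P}) = order G * card P"
proof -
  have count: "card {x \<in> carrier G. Q x} = (\<Sum>x\<in>carrier G. if Q x then 1 else 0)" for Q
    using fin by (simp add: sum.If_cases Collect_conj_eq)
  have "(\<Sum>s\<in>carrier G. card {y \<in> carrier G. y \<otimes> s \<otimes> inv y \<in> P}) =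
      (\<Sum>y\<in>carrier G. card {s \<in> carrier G. y \<otimes> s \<otimes> inv y \<in> P})"
    unfolding count by (rule sum.swap)
  also have "\<dots> = (\<Sum>y\<in>carrier G. card P)"
  proof (rule sum.cong[OF refl])
    fix y assume y: "y \<in> carrier G"
    have "bij_betw (\<lambda>s. y \<otimes> s \<otimes> inv y) {s \<in> carrier G. y \<otimes> s \<otimes> inv y \<in> P} P"
      by (rule bij_betwI[where g = "\<lambda>s. inv y \<otimes> s \<otimes> y"])
        (use y P in \<open>auto simp: m_assoc cancel_inv_left cancel_left_inv subset_eq\<close>)
    then show "card {s \<in> carrier G. y \<otimes> s \<otimes> inv y \<in> P} = card P"
      by (rule bij_betw_same_card)
  qed
  also have "\<dots> = order G * card P" by (simp add: order_def)
  finally show ?thesis .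
qed

lemma exists_element_of_prime_order:
  assumes C: "subgroup C G" and fin: "finite (carrier G)" and q: "prime q" "q dvd card C"
  obtains u where "u \<in> C" "u \<noteq> \<one>" "u [^] q = \<one>"
proof -
  interpret C: group "G\<lparr>carrier := C\<rparr>" using C by (rule subgroup_imp_group)
  have finC: "finite C" using C fin by (meson finite_subset subgroup.subset)
  obtain n where "card C = q * n" using q by blast
  then have "order (G\<lparr>carrier := C\<rparr>) = q ^ 1 * n" by (simp add: order_def)
  then obtain K where K: "subgroup K (G\<lparr>carrier := C\<rparr>)" "card K = q"
    using sylow_thm[OF q(1) C.is_group, of 1 n] finC by auto
  have KG: "subgroup K G" using K(1) C by (simp add: incl_subgroup)
  have "card K > 1" using prime_gt_1_nat[OF q(1)] K(2) by simp
  then have "\<not> K \<subseteq> {\<one>}" using card_mono[of "{\<one>}" K] by auto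
  then obtain u where u: "u \<in> K" "u \<noteq> \<one>" by blast
  interpret K: group "G\<lparr>carrier := K\<rparr>" using KG by (rule subgroup_imp_group)
  have "u [^]\<^bsub>G\<lparr>carrier := K\<rparr>\<^esub> q = \<one>"
    using K.pow_order_eq_1[of u] u K(2) by (simp add: order_def)
  then have "u [^] q = \<one>" by (simp add: nat_pow_consistent[symmetric])
  moreover have "u \<in> C" using K(1) u subgroup.subset by fastforce
  ultimately show thesis using u that by blast
qed

lemma centralizer_is_three_group:
  assumes fin: "finite (carrier G)" and order: "order G = 3 ^ k * m"
    and s: "s \<in> carrier G"
    and none: "\<And>u. \<lbrakk>u \<in> centralizer s; u [^] m = \<one>\<rbrakk> \<Longrightarrow> u = \<one>"
  obtains j where "card (centralizer s) = 3 ^ j"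
proof -
  have C: "subgroup (centralizer s) G" using s by (rule centralizer_subgroup)
  have dvd: "card (centralizer s) dvd 3 ^ k * m"
    using lagrange[OF C] order by (metis dvd_triv_right)
  have card_nz: "card (centralizer s) \<noteq> 0"
    using C fin by (metis card_0_eq empty_iff finite_subset subgroup.one_closed subgroup.subset)
  have "\<not> is_unit (3::nat)" by simp
  then obtain r where r: "card (centralizer s) = 3 ^ multiplicity 3 (card (centralizer s)) * r" "\<not> 3 dvd r"
    using multiplicity_decompose'[OF card_nz] by blast
  define j where "j = multiplicity 3 (card (centralizer s))"
  have jr: "card (centralizer s) = 3 ^ j * r" "\<not> 3 dvd r" using r by (simp_all add: j_def)
  have "r = 1"
  proof (rule ccontr)
    assume "r \<noteq> 1"
    then obtain q where q: "prime q" "q dvd r"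
      using prime_factor_nat by blast
    then have "q dvd 3 ^ k * m" using dvd jr(1) by (metis dvd_mult dvd_trans)
    moreover have "coprime q (3 ^ k)"
      using q jr(2) primes_coprime[of q 3] by (cases "k = 0") auto
    ultimately have "q dvd m" by (simp add: coprime_dvd_mult_right_iff)
    obtain u where u: "u \<in> centralizer s" "u \<noteq> \<one>" "u [^] q = \<one>"
      using exists_element_of_prime_order[OF C fin q(1)] q(2) jr(1) by auto
    have "u \<in> carrier G" using u(1) by (simp add: centralizer_def)
    then have "u [^] m = \<one>"
      using \<open>q dvd m\<close> u(3) by (simp add: pow_eq_id) (meson dvd_trans)
    then show False using none u by blast
  qed
  then show thesis using jr(1) that by simp
qed

text \<open>If \<open>s\<close> is a cube root of one and commutes with \<open>u \<noteq> 1\<close> where \<open>u^m = 1\<close>, then \<open>su\<close> is not a cube root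
of one. Moreover \<open>s\<close> is determined by \<open>su\<close>, namely as its 3-part, so there are no more such \<open>s\<close> than
elements that are not cube roots of one.\<close>

lemma card_roots_with_coprime_centralizing_element:
  fixes m :: nat
  assumes fin: "finite (carrier G)" and m: "\<not> 3 dvd m"
  shows "card {s \<in> cube_roots. \<exists>u \<in> centralizer s. u [^] m = \<one> \<and> u \<noteq> \<one>} + card cube_roots \<le> order G"
proof -
  let ?B = "{s \<in> cube_roots. \<exists>u \<in> centralizer s. u [^] m = \<one> \<and> u \<noteq> \<one>}"
  obtain u where u: "\<And>s. s \<in> ?B \<Longrightarrow> u s \<in> centralizer s \<and> u s [^] m = \<one> \<and> u s \<noteq> \<one>"
    by (rule that[of "\<lambda>s. SOME u. u \<in> centralizer s \<and> u [^] m = \<one> \<and> u \<noteq> \<one>"])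
      (rule someI_ex, blast)
  have carr: "s \<in> carrier G" "u s \<in> carrier G" if "s \<in> ?B" for s
    using u[OF that] that by (auto simp: cube_roots_def centralizer_def)
  have pow: "(s \<otimes> u s) [^] n = s [^] n \<otimes> u s [^] n" if "s \<in> ?B" for s and n :: nat
    using u[OF that] carr[OF that] pow_mult_distrib[of s "u s" n]
    by (simp add: centralizer_def commuting_def)
  have "card ?B \<le> card (carrier G - cube_roots)"
  proof (rule card_inj_on_le[where f = "\<lambda>s. s \<otimes> u s"])
    show "inj_on (\<lambda>s. s \<otimes> u s) ?B"
    proof (rule inj_on_inverseI[where g = "\<lambda>x. x [^] (m * m)"])
      fix s assume s: "s \<in> ?B"
      \<comment> \<open>The power \<open>m * m\<close> extracts the 3-part: \<open>m * m\<close> is 1 modulo 3 and 0 modulo \<open>m\<close>.\<close>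
      have "m * m mod 3 = 1"
      proof -
        have "m mod 3 = 1 \<or> m mod 3 = 2" using m by presburger
        then show ?thesis
        proof
          assume "m mod 3 = 1"
          then show ?thesis using mod_mult_eq[of m 3 m] by simp
        next
          assume "m mod 3 = 2"
          then show ?thesis using mod_mult_eq[of m 3 m] by simp
        qed
      qed
      then obtain q where q: "m * m = 3 * q + 1" using mult_div_mod_eq[of 3 "m * m"] by metis
      have "s [^] (m * m) = (s [^] (3::nat)) [^] q \<otimes> s"
        unfolding q using carr[OF s] by (simp add: nat_pow_mult nat_pow_pow)
      also have "\<dots> = s" using s carr[OF s] by (simp add: cube_roots_def)
      finally have 1: "s [^] (m * m) = s" .
      have "u s [^] (m * m) = (u s [^] m) [^] m" using carr[OF s] by (simp add: nat_pow_pow)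
      then have "u s [^] (m * m) = \<one>" using u[OF s] by simp
      with 1 show "(s \<otimes> u s) [^] (m * m) = s" using pow[OF s] carr[OF s] by simp
    qed
    show "(\<lambda>s. s \<otimes> u s) ` ?B \<subseteq> carrier G - cube_roots"
    proof
      fix x assume "x \<in> (\<lambda>s. s \<otimes> u s) ` ?B"
      then obtain s where s: "s \<in> ?B" and x: "x = s \<otimes> u s" by blast
      have "u s [^] (3::nat) \<noteq> \<one>"
      proof
        assume "u s [^] (3::nat) = \<one>"
        then have "ord (u s) dvd 3" "ord (u s) dvd m"
          using u[OF s] carr[OF s] by (simp_all add: pow_eq_id)
        moreover have "coprime 3 m" using m prime_imp_coprime[of 3 m] by simp
        ultimately have "ord (u s) = 1" by (meson coprime_common_divisor_nat coprime_def nat_dvd_1_iff_1)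
        then show False using u[OF s] ord_eq_1[OF carr(2)[OF s]] by blast
      qed
      then have "x [^] (3::nat) \<noteq> \<one>"
        using pow[OF s, of 3] s carr[OF s] x by (simp add: cube_roots_def)
      then show "x \<in> carrier G - cube_roots" using carr[OF s] x by (auto simp: cube_roots_def)
    qed
    show "finite (carrier G - cube_roots)" using fin by simp
  qed
  also have "card (carrier G - cube_roots) = order G - card cube_roots"
    unfolding order_def using fin by (intro card_Diff_subset) (auto simp: cube_roots_def)
  finally show ?thesis
    using card_mono[OF fin, of cube_roots] by (simp add: cube_roots_def order_def subset_eq)
qed

lemma cube_root_generates_three_group:
  assumes "s \<in> cube_roots"
  obtains j where "subgroup (generate G {s}) G" "card (generate G {s}) = 3 ^ j"
proof -
  have s: "s \<in> carrier G" "s [^] (3::nat) = \<one>" using assms by (simp_all add: cube_roots_def)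
  have "ord s dvd 3" using s by (simp add: pow_eq_id)
  then have "ord s dvd 3 ^ 1" by simp
  then obtain j where "ord s = 3 ^ j"
    using divides_primepow_nat[of 3 "ord s" 1] by auto
  moreover have "subgroup (generate G {s}) G" using s by (intro generate_is_subgroup) simp
  ultimately show thesis using that generate_pow_card[OF s(1)] by simp
qed

lemma card_conjugators_of_cube_root:
  assumes fin: "finite (carrier G)" and P: "subgroup P G" and s: "s \<in> cube_roots"
  shows "card P * (card (rcosets P) mod 3) \<le> card {y \<in> carrier G. y \<otimes> s \<otimes> inv y \<in> P}"
proof -
  obtain j where H: "subgroup (generate G {s}) G" "card (generate G {s}) = 3 ^ j"
    using cube_root_generates_three_group[OF s] by blast
  have "prime (3::nat)" by simp
  then obtain f where f: "card {g \<in> carrier G. \<forall>h \<in> generate G {s}. g \<otimes> h \<otimes> inv g \<in> P} = card P * f"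
    "f mod 3 = card (rcosets P) mod 3"
    using card_conjugators_into[OF fin P H(1) _ H(2)] by blast
  have "card P * (card (rcosets P) mod 3) = card P * (f mod 3)" by (simp add: f(2))
  also have "\<dots> \<le> card P * f" by simp
  also have "\<dots> \<le> card {y \<in> carrier G. y \<otimes> s \<otimes> inv y \<in> P}"
    unfolding f(1)[symmetric] using fin by (intro card_mono) (auto intro: generate.incl)
  finally show ?thesis .
qed

text \<open>More than \<open>7/9 - 2/9 = 5/9\<close> of the elements are cube roots of one whose centralizer is a 3-group.
Such a centralizer has a conjugate inside \<open>P\<close>, because \<open>3\<close> does not divide the index of \<open>P\<close>. So more
than a third of the conjugates of such an element lie in \<open>P\<close>. Counting pairs of an
element and a conjugator gives \<open>|P| > 5/27 |G|\<close>, that is, \<open>m < 27/5\<close>.\<close>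

lemma Sylow_three_index_le_five:
  assumes many: many_cube_roots and order: "order G = 3 ^ k * m" and m: "\<not> 3 dvd m"
    and P: "subgroup P G" and card_P: "card P = 3 ^ k"
  shows "m \<le> 5"
proof -
  have fin: "finite (carrier G)" and "7 * order G < 9 * card cube_roots"
    using many by (simp_all add: many_cube_roots_def)
  define bad where "bad = {s \<in> cube_roots. \<exists>u \<in> centralizer s. u [^] m = \<one> \<and> u \<noteq> \<one>}"
  define N where "N s = card {y \<in> carrier G. y \<otimes> s \<otimes> inv y \<in> P}" for s
  have finS: "finite cube_roots" using fin by (simp add: cube_roots_def)
  have "card bad + card cube_roots \<le> order G"
    unfolding bad_def by (rule card_roots_with_coprime_centralizing_element[OF fin m])
  moreover have "card (cube_roots - bad) = card cube_roots - card bad"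
    using finS by (intro card_Diff_subset) (auto simp: bad_def intro: finite_subset[OF _ finS])
  ultimately have good: "5 * order G < 9 * card (cube_roots - bad)"
    using \<open>7 * order G < 9 * card cube_roots\<close> by linarith
  have m_index: "card (rcosets P) = m"
    using lagrange[OF P] order card_P by simp
  have "order G \<le> 3 * N s" if s: "s \<in> cube_roots - bad" for s
  proof -
    have sc: "s \<in> carrier G" using s by (simp add: cube_roots_def)
    have none: "u = \<one>" if "u \<in> centralizer s" "u [^] m = \<one>" for u
      using s that by (auto simp: bad_def)
    obtain j where j: "card (centralizer s) = 3 ^ j"
      using centralizer_is_three_group[OF fin order sc none] by blast
    have "prime (3::nat)" by simp
    then obtain f where f: "card {g \<in> carrier G. \<forall>h \<in> centralizer s. g \<otimes> h \<otimes> inv g \<in> P} = card P * f"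
      "f mod 3 = card (rcosets P) mod 3"
      using card_conjugators_into[OF fin P centralizer_subgroup[OF sc] _ j] by blast
    have "f \<noteq> 0" using f(2) m m_index by (auto simp: dvd_eq_mod_eq_0)
    then have "card {g \<in> carrier G. \<forall>h \<in> centralizer s. g \<otimes> h \<otimes> inv g \<in> P} \<noteq> 0"
      unfolding f(1) card_P by simp
    then obtain g where "g \<in> carrier G" "\<And>h. h \<in> centralizer s \<Longrightarrow> g \<otimes> h \<otimes> inv g \<in> P"
      by (metis (no_types, lifting) card.empty empty_Collect_eq)
    then show ?thesis
      using card_conjugators_if_centralizer_conjugate[OF many P sc] by (force simp: N_def)
  qed
  then have "card (cube_roots - bad) * order G \<le> (\<Sum>s\<in>cube_roots - bad. 3 * N s)"
    using sum_mono[of "cube_roots - bad" "\<lambda>_. order G" "\<lambda>s. 3 * N s"] by simp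
  also have "\<dots> \<le> 3 * (\<Sum>s\<in>carrier G. N s)"
    using fin by (simp add: sum_distrib_left[symmetric] cube_roots_def) (intro sum_mono2; auto)
  also have "\<dots> = 3 * (order G * card P)"
    unfolding N_def by (subst sum_card_conjugators[OF fin]) (use P in \<open>simp_all add: subgroup.subset\<close>)
  finally have "card (cube_roots - bad) * order G \<le> (3 * card P) * order G" by (simp add: ac_simps)
  moreover have "order G > 0" using fin by (simp add: order_gt_0_iff_finite)
  ultimately have "card (cube_roots - bad) \<le> 3 * card P" by simp
  moreover have "5 * (card P * m) < 9 * card (cube_roots - bad)"
    using good order card_P by simp
  ultimately have "5 * (card P * m) < 27 * card P" by linarith
  then have "(5 * m) * card P < 27 * card P" by (simp add: ac_simps)
  then have "5 * m < 27" by simp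
  then show ?thesis by simp
qed

text \<open>The subgroup \<open>R = P \<inter> g\<^sup>-\<^sup>1Pg\<close> is the stabilizer in \<open>P\<close> of the coset \<open>Pg\<close>, whose orbit lies among the
three cosets other than \<open>P\<close>.\<close>

lemma card_intersection_conjugate:
  assumes fin: "finite (carrier G)" and P: "subgroup P G" and index: "card (rcosets P) = 4"
    and g: "g \<in> carrier G" "g \<notin> P"
  defines "R \<equiv> {r \<in> P. g \<otimes> r \<otimes> inv g \<in> P}"
  shows "subgroup R G" and "card P \<le> 3 * card R"
proof -
  interpret P: subgroup P G by (rule P)
  have conj_mult: "g \<otimes> (x \<otimes> y) \<otimes> inv g = (g \<otimes> x \<otimes> inv g) \<otimes> (g \<otimes> y \<otimes> inv g)"
    if "x \<in> carrier G" "y \<in> carrier G" for x y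
    using that g by (simp add: m_assoc cancel_inv_left)
  have conj_inv: "g \<otimes> inv x \<otimes> inv g = inv (g \<otimes> x \<otimes> inv g)" if "x \<in> carrier G" for x
    using that g by (simp add: m_assoc inv_mult_group)
  show "subgroup R G"
  proof
    show "R \<subseteq> carrier G" by (auto simp: R_def)
    show "\<one> \<in> R" using g by (simp add: R_def)
    show "x \<otimes> y \<in> R" if "x \<in> R" "y \<in> R" for x y
      using that by (simp add: R_def conj_mult)
    show "inv x \<in> R" if "x \<in> R" for x
      using that by (simp add: R_def conj_inv)
  qed
  have finP: "finite P" using fin by (rule finite_subset[OF P.subset])
  define c where "c p = P #> (g \<otimes> p)" for p
  have finR: "finite (rcosets P)"
    using fin rcosets_part_G[OF P] by (metis finite_UnionD)
  have img: "c ` P \<subseteq> rcosets P - {P}"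
  proof
    fix C assume "C \<in> c ` P"
    then obtain p where p: "p \<in> P" "C = P #> (g \<otimes> p)" by (auto simp: c_def)
    have "C \<noteq> P"
    proof
      assume "C = P"
      then have "g \<otimes> p \<in> P" using p rcos_self[of "g \<otimes> p" P] P g by auto
      then have "g \<otimes> p \<otimes> inv p \<in> P" using p by blast
      then show False using p g by (simp add: m_assoc)
    qed
    then show "C \<in> rcosets P - {P}" using p g rcosetsI[OF P.subset, of "g \<otimes> p"] by simp
  qed
  have "P \<in> rcosets P" using P.subgroup_in_rcosets[OF is_group] .
  then have "card (rcosets P - {P}) = 3" using finR index by simp
  then have img3: "card (c ` P) \<le> 3" using card_mono[OF _ img] finR by simp
  have fibre: "card {p \<in> P. c p = C} \<le> card R" if C: "C \<in> c ` P" for C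
  proof -
    obtain p0 where p0: "p0 \<in> P" "C = c p0" using C by blast
    show ?thesis
    proof (rule card_inj_on_le[where f = "\<lambda>p. p \<otimes> inv p0"])
      show "inj_on (\<lambda>p. p \<otimes> inv p0) {p \<in> P. c p = C}"
        using p0 by (auto simp: inj_on_def)
      show "(\<lambda>p. p \<otimes> inv p0) ` {p \<in> P. c p = C} \<subseteq> R"
      proof clarify
        fix p assume p: "p \<in> P" "C = c p"
        then have "P #> (g \<otimes> p) = P #> (g \<otimes> p0)" using p0(2) unfolding c_def by metis
        moreover have "g \<otimes> p \<in> P #> (g \<otimes> p)" using p(1) g P by (intro rcos_self) simp_all
        ultimately have "g \<otimes> p \<in> P #> (g \<otimes> p0)" by (simp only:)
        then have "(g \<otimes> p) \<otimes> inv (g \<otimes> p0) \<in> P"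
          using P.rcos_module[OF is_group, of "g \<otimes> p0" "g \<otimes> p"] p p0 g by simp
        also have "(g \<otimes> p) \<otimes> inv (g \<otimes> p0) = g \<otimes> (p \<otimes> inv p0) \<otimes> inv g"
          using p p0 g by (simp add: m_assoc inv_mult_group)
        finally show "p \<otimes> inv p0 \<in> R" using p p0 by (simp add: R_def)
      qed
      show "finite R" using finP by (simp add: R_def)
    qed
  qed
  have "card P = (\<Sum>C\<in>c ` P. card {p \<in> P. c p = C})"
    using sum.image_gen[OF finP, of "\<lambda>_. 1::nat" c] by simp
  also have "\<dots> \<le> (\<Sum>C\<in>c ` P. card R)" using fibre by (rule sum_mono)
  also have "\<dots> \<le> 3 * card R" using img3 by simp
  finally show "card P \<le> 3 * card R" .
qed

text \<open>Every cube root of one fixes at least two cosets of \<open>P\<close>, whereas the average number of fixed cosets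
over the whole group is 1.\<close>

lemma Sylow_three_index_not_two_mod_three:
  assumes many: many_cube_roots and P: "subgroup P G"
  shows "card (rcosets P) mod 3 \<noteq> 2"
proof
  assume m: "card (rcosets P) mod 3 = 2"
  have fin: "finite (carrier G)" and S: "7 * order G < 9 * card cube_roots"
    using many by (simp_all add: many_cube_roots_def)
  define N where "N s = card {y \<in> carrier G. y \<otimes> s \<otimes> inv y \<in> P}" for s
  have "card P * 2 \<le> N s" if "s \<in> cube_roots" for s
    using card_conjugators_of_cube_root[OF fin P that] m by (simp add: N_def)
  then have "(\<Sum>s\<in>cube_roots. card P * 2) \<le> (\<Sum>s\<in>cube_roots. N s)" by (rule sum_mono)
  also have "\<dots> \<le> (\<Sum>s\<in>carrier G. N s)"
    using fin by (intro sum_mono2) (auto simp: cube_roots_def)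
  also have "\<dots> = order G * card P"
    unfolding N_def using sum_card_conjugators[OF fin] P by (simp add: subgroup.subset)
  finally have "(2 * card cube_roots) * card P \<le> order G * card P" by (simp add: ac_simps)
  moreover have "card P \<noteq> 0"
    using P fin by (metis card_0_eq empty_iff finite_subset subgroup.one_closed subgroup.subset)
  ultimately have "2 * card cube_roots \<le> order G" by simp
  then show False using S by linarith
qed

text \<open>Every cube root of one fixes a coset of \<open>P\<close>. The 3-group \<open>R = P \<inter> g\<^sup>-\<^sup>1Pg\<close> fixes the cosets \<open>P\<close> and
\<open>Pg\<close>, hence all four, since the number of cosets it fixes is \<open>1\<close> modulo \<open>3\<close>. As the average number of
fixed cosets is 1, the number of cube roots of one is at most \<open>|G| - 3|R| \<le> |G| - |P| = 3/4 |G|\<close>,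
which is less than \<open>7/9 |G|\<close>.\<close>

lemma Sylow_three_index_not_four:
  assumes many: many_cube_roots and P: "subgroup P G" and card_P: "card P = 3 ^ k"
  shows "card (rcosets P) \<noteq> 4"
proof
  assume index: "card (rcosets P) = 4"
  have fin: "finite (carrier G)" and S: "7 * order G < 9 * card cube_roots"
    using many by (simp_all add: many_cube_roots_def)
  interpret P: subgroup P G by (rule P)
  have orderG: "order G = 4 * card P" using lagrange[OF P] index by simp
  have finP: "finite P" using fin by (rule finite_subset[OF P.subset])
  have "P \<noteq> carrier G" using orderG card_P by (auto simp: order_def)
  then obtain g where g: "g \<in> carrier G" "g \<notin> P" using P.subset by blast
  define R where "R = {r \<in> P. g \<otimes> r \<otimes> inv g \<in> P}"
  have R: "subgroup R G" and card_R: "card P \<le> 3 * card R"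
    unfolding R_def by (rule card_intersection_conjugate[OF fin P index g])+
  define N where "N s = card {y \<in> carrier G. y \<otimes> s \<otimes> inv y \<in> P}" for s
  have "subgroup R (G\<lparr>carrier := P\<rparr>)"
    using R P by (rule subgroup_incl) (simp add: R_def subset_eq)
  then have "card R dvd card P"
    using group.lagrange[OF subgroup_imp_group[OF P], of R]
    by (simp add: order_def) (metis dvd_triv_right)
  then obtain j where j: "card R = 3 ^ j"
    using card_P divides_primepow_nat[of 3 "card R" k] by auto
  have "prime (3::nat)" by simp
  then obtain f where f: "card {y \<in> carrier G. \<forall>h \<in> R. y \<otimes> h \<otimes> inv y \<in> P} = card P * f"
    "f mod 3 = card (rcosets P) mod 3"
    using card_conjugators_into[OF fin P R _ j] by blast
  have "card P < card P * f"
  proof -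
    have "insert g P \<subseteq> {y \<in> carrier G. \<forall>h \<in> R. y \<otimes> h \<otimes> inv y \<in> P}"
      using g by (auto simp: R_def)
    then have "card (insert g P) \<le> card P * f"
      unfolding f(1)[symmetric] using fin by (intro card_mono) auto
    moreover have "card (insert g P) = Suc (card P)" using g finP by simp
    ultimately show ?thesis by linarith
  qed
  then have "f > 1" by (cases f rule: nat.exhaust) auto
  then have f4: "4 \<le> f" using f(2) index by (simp; presburger)
  have NR: "card P * 4 \<le> N s" if "s \<in> R" for s
  proof -
    have "card P * 4 \<le> card P * f" using f4 by simp
    also have "\<dots> \<le> N s"
      unfolding f(1)[symmetric] N_def using fin that by (intro card_mono) auto
    finally show ?thesis .
  qed
  have NS: "card P \<le> N s" if "s \<in> cube_roots" for s
    using card_conjugators_of_cube_root[OF fin P that] index by (simp add: N_def)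
  have finS: "finite cube_roots" using fin by (simp add: cube_roots_def)
  have finR: "finite R" using finP by (simp add: R_def)
  have "card P * card (cube_roots - R) + card P * 4 * card R
      = (\<Sum>s\<in>cube_roots - R. card P) + (\<Sum>s\<in>R. card P * 4)" by simp
  also have "\<dots> \<le> (\<Sum>s\<in>cube_roots - R. N s) + (\<Sum>s\<in>R. N s)"
    using NR NS by (intro add_mono sum_mono) auto
  also have "\<dots> = (\<Sum>s\<in>(cube_roots - R) \<union> R. N s)"
    using finS finR by (intro sum.union_disjoint[symmetric]) auto
  also have "\<dots> \<le> (\<Sum>s\<in>carrier G. N s)"
    using fin R by (intro sum_mono2) (auto simp: cube_roots_def R_def)
  also have "\<dots> = order G * card P"
    unfolding N_def using sum_card_conjugators[OF fin] P by (simp add: subgroup.subset)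
  finally have "(card (cube_roots - R) + 4 * card R) * card P \<le> order G * card P"
    by (simp add: algebra_simps)
  moreover have "card P \<noteq> 0" using card_P by simp
  ultimately have "card (cube_roots - R) + 4 * card R \<le> order G" by simp
  moreover have "card cube_roots \<le> card (cube_roots - R) + card R"
    using finR by (metis card_Un_le card_mono finS finite_Diff finite_UnI Un_Diff_cancel2 Un_upper1 le_trans)
  ultimately show False using S orderG card_R by linarith
qed

theorem order_power_of_three:
  assumes many: many_cube_roots
  obtains k where "order G = 3 ^ k"
proof -
  have fin: "finite (carrier G)" using many by (simp add: many_cube_roots_def)
  have "order G \<noteq> 0" using fin by (simp add: order_gt_0_iff_finite)
  moreover have "\<not> is_unit (3::nat)" by simp
  ultimately obtain m where m: "order G = 3 ^ multiplicity 3 (order G) * m" "\<not> 3 dvd m"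
    using multiplicity_decompose' by blast
  define k where "k = multiplicity 3 (order G)"
  have order: "order G = 3 ^ k * m" using m(1) by (simp add: k_def)
  have "prime (3::nat)" by simp
  then obtain P where P: "subgroup P G" and card_P: "card P = 3 ^ k"
    using sylow_thm[of 3 G k m] order fin is_group by auto
  have index: "card (rcosets P) = m" using lagrange[OF P] order card_P by simp
  have "m \<le> 5" using Sylow_three_index_le_five[OF many order m(2) P card_P] .
  moreover have "m mod 3 \<noteq> 2" using Sylow_three_index_not_two_mod_three[OF many P] index by simp
  moreover have "m \<noteq> 4" using Sylow_three_index_not_four[OF many P card_P] index by simp
  ultimately have "m = 1" using m(2) by presburger
  then show thesis using order that by simp
qed

end

section \<open>Exponent three from the density of cube roots\<close>

context group
begin

text \<open>If \<open>z\<^sup>3 \<noteq> 1\<close> for a central \<open>z\<close>, then \<open>x\<close> and \<open>xz\<close> are never both cube roots of one, so that the cube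
roots of one make up at most half of the group.\<close>

lemma many_cube_roots_center_pow3:
  assumes many: many_cube_roots and z: "z \<in> center G"
  shows "z [^] (3::nat) = \<one>"
proof (rule ccontr)
  assume nz: "z [^] (3::nat) \<noteq> \<one>"
  have fin: "finite (carrier G)" and S: "7 * order G < 9 * card cube_roots"
    using many by (simp_all add: many_cube_roots_def)
  have zc: "z \<in> carrier G" using z by (rule center_carrier)
  let ?S' = "{x \<in> carrier G. x \<otimes> z \<in> cube_roots}"
  have "card ?S' = card cube_roots"
    by (rule card_right_translate[OF zc]) (auto simp: cube_roots_def)
  moreover have "cube_roots \<inter> ?S' = {}"
  proof -
    have "(x \<otimes> z) [^] (3::nat) = x [^] (3::nat) \<otimes> z [^] (3::nat)" if "x \<in> carrier G" for x
      using pow_mult_distrib[of x z 3] center_commute[OF z that] that zc by simp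
    then show ?thesis using nz zc by (auto simp: cube_roots_def)
  qed
  then have "card cube_roots + card ?S' = card (cube_roots \<union> ?S')"
    using fin by (intro card_Un_disjoint[symmetric]) (auto simp: cube_roots_def)
  moreover have "card (cube_roots \<union> ?S') \<le> order G"
    unfolding order_def using fin by (intro card_mono) (auto simp: cube_roots_def)
  ultimately show False using S by linarith
qed

lemma exponent_three_if_central_cubes:
  assumes "many_cube_roots" and "\<And>x. x \<in> carrier G \<Longrightarrow> x [^] (3::nat) \<in> center G"
    and x: "x \<in> carrier G"
  shows "x [^] (3::nat) = \<one>"
proof -
  interpret central_cubes_many G
    by unfold_locales (use assms many_cube_roots_center_pow3 in auto)
  show ?thesis using x by (rule exponent_three)
qed

end

lemma (in normal) pow_in_iff:
  assumes "x \<in> carrier G"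
  shows "(H #> x) [^]\<^bsub>G Mod H\<^esub> (n::nat) = \<one>\<^bsub>G Mod H\<^esub> \<longleftrightarrow> x [^] n \<in> H"
proof -
  interpret Q: group_hom G "G Mod H" "\<lambda>x. H #> x" by (rule quotient_hom)
  show ?thesis
    using assms quotient_eq_one_iff[of "x [^] n"] Q.hom_nat_pow[OF assms, of n] by simp
qed

lemma (in normal) many_cube_roots_quotient:
  assumes fin: "finite (carrier G)"
    and many: "7 * order G < 9 * card {x \<in> carrier G. x [^] (3::nat) \<in> H}"
  shows "group.many_cube_roots (G Mod H)"
proof -
  interpret Q: group "G Mod H" by (rule factorgroup_is_group)
  have carrierQ: "carrier (G Mod H) = rcosets H" by (simp add: FactGroup_def)
  have "{x \<in> carrier G. x [^] (3::nat) \<in> H} = \<Union>Q.cube_roots"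
  proof (intro equalityI subsetI)
    fix x assume "x \<in> {x \<in> carrier G. x [^] (3::nat) \<in> H}"
    then have "H #> x \<in> Q.cube_roots" "x \<in> H #> x"
      using pow_in_iff[of x 3] rcosetsI[OF subset, of x] rcos_self[of x H]
      by (auto simp: Q.cube_roots_def carrierQ is_subgroup)
    then show "x \<in> \<Union>Q.cube_roots" by blast
  next
    fix x assume "x \<in> \<Union>Q.cube_roots"
    then obtain C where C: "C \<in> rcosets H" "C [^]\<^bsub>G Mod H\<^esub> (3::nat) = \<one>\<^bsub>G Mod H\<^esub>" "x \<in> C"
      by (auto simp: Q.cube_roots_def carrierQ)
    then have x: "x \<in> carrier G" using rcosets_part_G[OF is_subgroup] by blast
    obtain a where "a \<in> carrier G" "C = H #> a" using C(1) by (auto simp: RCOSETS_def)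
    then have "C = H #> x" using C(3) repr_independence[OF _ _ is_subgroup] by auto
    then show "x \<in> {x \<in> carrier G. x [^] (3::nat) \<in> H}"
      using C(2) x pow_in_iff[of x 3] by simp
  qed
  then have "card {x \<in> carrier G. x [^] (3::nat) \<in> H} = card H * card Q.cube_roots"
    using card_Union_rcosets[OF fin is_subgroup, of Q.cube_roots]
    by (auto simp: Q.cube_roots_def carrierQ)
  moreover have "order G = card H * order (G Mod H)"
    using lagrange[OF is_subgroup] by (simp add: order_def FactGroup_def mult.commute)
  ultimately have "card H * (7 * order (G Mod H)) < card H * (9 * card Q.cube_roots)"
    using many by (simp add: ac_simps)
  then have "7 * order (G Mod H) < 9 * card Q.cube_roots" by simp
  moreover have "finite (carrier (G Mod H))"
    using fin rcosets_part_G[OF is_subgroup] unfolding carrierQ by (metis finite_UnionD)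
  ultimately show ?thesis by (simp add: Q.many_cube_roots_def)
qed

lemma (in normal) center_preimage_normal:
  "{x \<in> carrier G. H #> x \<in> center (G Mod H)} \<lhd> G"
proof -
  interpret Q: group_hom G "G Mod H" "\<lambda>x. H #> x" by (rule quotient_hom)
  interpret Z: normal "center (G Mod H)" "G Mod H" by (rule Q.H.center_normal)
  show ?thesis
    unfolding normal_inv_iff
  proof (intro conjI ballI)
    show "subgroup {x \<in> carrier G. H #> x \<in> center (G Mod H)} G"
      by unfold_locales (auto simp del: mult_FactGroup one_FactGroup)
    show "x \<otimes> h \<otimes> inv x \<in> {x \<in> carrier G. H #> x \<in> center (G Mod H)}"
      if "x \<in> carrier G" "h \<in> {x \<in> carrier G. H #> x \<in> center (G Mod H)}" for x h
      using that Z.inv_op_closed2[of "H #> x" "H #> h"]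
      by (auto simp del: mult_FactGroup one_FactGroup)
  qed
qed

context group
begin

text \<open>Induction on the index of \<open>N\<close>. The quotient \<open>G/N\<close> is a 3-group, so if it is nontrivial, its center
has a preimage \<open>M\<close> that is larger than \<open>N\<close>. The induction hypothesis for \<open>M\<close> says that the cubes of
\<open>G/N\<close> are central, so lemma \<open>exponent_three_if_central_cubes\<close> applies to \<open>G/N\<close>. Working with normal
subgroups of a fixed group keeps all the quotients at the same type.\<close>

lemma cubes_in_normal:
  assumes fin: "finite (carrier G)"
  shows "\<lbrakk>N \<lhd> G; 7 * order G < 9 * card {x \<in> carrier G. x [^] (3::nat) \<in> N}; x \<in> carrier G\<rbrakk>
    \<Longrightarrow> x [^] (3::nat) \<in> N"
proof (induction "order G - card N" arbitrary: N x rule: less_induct)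
  case less
  interpret normal N G by (rule less.prems(1))
  interpret Q: group_hom G "G Mod N" "\<lambda>x. N #> x" by (rule quotient_hom)
  have manyQ: "Q.H.many_cube_roots" using many_cube_roots_quotient[OF fin less.prems(2)] .
  have finQ: "finite (carrier (G Mod N))" using manyQ by (simp add: Q.H.many_cube_roots_def)
  obtain k where k: "order (G Mod N) = 3 ^ k"
    using Q.H.order_power_of_three[OF manyQ] by blast
  show ?case
  proof (cases "k = 0")
    case True
    then have "carrier (G Mod N) = {\<one>\<^bsub>G Mod N\<^esub>}"
      using k Q.H.one_closed by (metis card_1_singletonE order_def power_0 singletonD)
    then have "N = carrier G" using fact_group_trivial_iff[OF fin] by blast
    then show ?thesis using less.prems(3) by simp
  next
    case False
    define M where "M = {x \<in> carrier G. N #> x \<in> center (G Mod N)}"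
    have M: "M \<lhd> G" unfolding M_def by (rule center_preimage_normal)
    have NM: "N \<subseteq> M"
    proof
      fix x assume x: "x \<in> N"
      then have "N #> x = \<one>\<^bsub>G Mod N\<^esub>" using quotient_eq_one_iff[OF mem_carrier[OF x]] by blast
      then show "x \<in> M" using x Q.H.center_one by (simp add: M_def del: one_FactGroup)
    qed
    have "center (G Mod N) \<noteq> {\<one>\<^bsub>G Mod N\<^esub>}"
      by (rule Q.H.center_of_p_group[OF finQ _ k False]) simp
    then obtain C where C: "C \<in> center (G Mod N)" "C \<noteq> \<one>\<^bsub>G Mod N\<^esub>"
      using Q.H.center_one by blast
    then obtain a where a: "a \<in> carrier G" "C = N #> a"
      using Q.H.center_carrier[OF C(1)] by (auto simp: FactGroup_def RCOSETS_def)
    then have "a \<in> M" "a \<notin> N"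
      using C quotient_eq_one_iff[of a] by (simp_all add: M_def)
    then have "N \<subset> M" using NM by blast
    have MG: "M \<subseteq> carrier G" by (auto simp: M_def)
    have finM: "finite M" using MG fin by (rule finite_subset)
    have "card N < card M" using finM \<open>N \<subset> M\<close> by (rule psubset_card_mono)
    moreover have "card M \<le> order G" unfolding order_def using fin MG by (rule card_mono)
    ultimately have "order G - card M < order G - card N" by simp
    moreover have "card {x \<in> carrier G. x [^] (3::nat) \<in> N} \<le> card {x \<in> carrier G. x [^] (3::nat) \<in> M}"
      using fin NM by (intro card_mono) auto
    then have "7 * order G < 9 * card {x \<in> carrier G. x [^] (3::nat) \<in> M}"
      using less.prems(2) by linarith
    ultimately have cubes_M: "y [^] (3::nat) \<in> M" if "y \<in> carrier G" for y
      using less.hyps[OF _ M] that by blast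
    have "Cy [^]\<^bsub>G Mod N\<^esub> (3::nat) \<in> center (G Mod N)" if Cy: "Cy \<in> carrier (G Mod N)" for Cy
    proof -
      obtain y where "y \<in> carrier G" "Cy = N #> y"
        using Cy by (auto simp: FactGroup_def RCOSETS_def)
      then show ?thesis using cubes_M[of y] Q.hom_nat_pow[of y 3] by (simp add: M_def)
    qed
    then have "(N #> x) [^]\<^bsub>G Mod N\<^esub> (3::nat) = \<one>\<^bsub>G Mod N\<^esub>"
      by (rule Q.H.exponent_three_if_central_cubes[OF manyQ _ Q.hom_closed[OF less.prems(3)]])
    then show ?thesis using pow_in_iff[OF less.prems(3)] by blast
  qed
qed

end

section \<open>Pairs of elements that commute with a cube\<close>

context group
begin

text \<open>Modulo a subgroup of index 2 the element \<open>g\<close> is congruent to its cube.\<close>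

lemma index_two_cube:
  assumes M: "subgroup M G" and index: "card (rcosets M) = 2"
    and g: "g \<in> carrier G" "g [^] (3::nat) \<in> M"
  shows "g \<in> M"
proof (rule ccontr)
  assume gM: "g \<notin> M"
  interpret M: subgroup M G by (rule M)
  have in_iff: "M #> x = M #> y \<longleftrightarrow> x \<otimes> inv y \<in> M" if "x \<in> carrier G" "y \<in> carrier G" for x y
    using that M.rcos_module[OF is_group, of y x] rcos_self[of x M] M repr_independence[of x M y]
    by auto
  have 1: "M #> \<one> \<in> rcosets M" "M #> g \<in> rcosets M" "M #> (g \<otimes> g) \<in> rcosets M"
    using g(1) by (auto intro: rcosetsI[OF M.subset])
  have "g \<otimes> g \<notin> M"
  proof
    assume "g \<otimes> g \<in> M"
    then have "g [^] (3::nat) \<otimes> inv (g \<otimes> g) \<in> M" using g by blast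
    moreover have "g [^] (3::nat) \<otimes> inv (g \<otimes> g) = g"
      using g by (simp add: pow3 m_assoc inv_mult_group cancel_left_inv)
    ultimately show False using gM by simp
  qed
  then have "distinct [M #> \<one>, M #> g, M #> (g \<otimes> g)]"
    using g(1) gM in_iff[of g \<one>] in_iff[of "g \<otimes> g" \<one>] in_iff[of "g \<otimes> g" g]
    by (auto simp: m_assoc)
  then have "card {M #> \<one>, M #> g, M #> (g \<otimes> g)} = 3" by auto
  moreover have "finite (rcosets M)" using index by (metis card.infinite zero_neq_numeral)
  then have "card {M #> \<one>, M #> g, M #> (g \<otimes> g)} \<le> card (rcosets M)"
    using 1 by (intro card_mono) auto
  ultimately show False using index by simp
qed

lemma sum_le_split:
  fixes c :: "'a \<Rightarrow> nat"
  assumes "finite A" "L \<subseteq> A" "\<And>y. y \<in> L \<Longrightarrow> c y \<le> n" "\<And>y. y \<in> A - L \<Longrightarrow> k * c y \<le> n"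
  shows "k * sum c A \<le> k * card L * n + (card A - card L) * n"
proof -
  have "sum c A = sum c L + sum c (A - L)"
    using assms(1,2) by (simp add: sum.subset_diff add.commute)
  moreover have "sum c L \<le> card L * n" using assms(3) sum_bounded_above[of L c n] by simp
  moreover have "k * sum c (A - L) \<le> card (A - L) * n"
    unfolding sum_distrib_left using assms(4) sum_bounded_above[of "A - L" "\<lambda>y. k * c y" n] by simp
  moreover have "card (A - L) = card A - card L"
    using assms(1,2) by (meson card_Diff_subset finite_subset)
  ultimately show ?thesis
    by (simp add: distrib_left mult.assoc add_mono mult_le_mono2)
qed

lemma card_commuting_with_cube_le:
  assumes fin: "finite (carrier G)" and y0: "y0 \<in> carrier G" "y0 [^] (3::nat) \<notin> center G"
  shows "27 * (\<Sum>y\<in>carrier G. card (centralizer (y [^] (3::nat)))) \<le> 23 * (order G * order G)"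
proof -
  define c where "c y = card (centralizer (y [^] (3::nat)))" for y
  define L where "L = {y \<in> carrier G. y [^] (3::nat) \<in> center G}"
  have LG: "L \<subseteq> carrier G" by (auto simp: L_def)
  have cle: "c y \<le> order G" for y
    unfolding c_def order_def using fin by (intro card_mono) (auto simp: centralizer_def)
  have sub: "subgroup (centralizer (y [^] (3::nat))) G" if "y \<in> carrier G" for y
    using that by (intro centralizer_subgroup) simp
  have lag: "card (rcosets (centralizer (y [^] (3::nat)))) * c y = order G" if "y \<in> carrier G" for y
    unfolding c_def using lagrange[OF sub[OF that]] .
  have nz: "order G > 0" using fin by (simp add: order_gt_0_iff_finite)
  have index: "card (rcosets (centralizer (y [^] (3::nat)))) \<ge> 2" if y: "y \<in> carrier G - L" for y
  proof -
    have "c y \<noteq> order G"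
    proof
      assume "c y = order G"
      then have "centralizer (y [^] (3::nat)) = carrier G"
        using fin unfolding c_def order_def by (intro card_subset_eq) (auto simp: centralizer_def)
      then show False using y by (auto simp: L_def center_def centralizer_def commuting_def)
    qed
    moreover have "card (rcosets (centralizer (y [^] (3::nat)))) * c y = order G"
      using lag y by blast
    ultimately have "card (rcosets (centralizer (y [^] (3::nat)))) \<notin> {0, 1}"
      using nz by (intro notI) auto
    then show ?thesis by simp
  qed
  have Lle: "card L \<le> order G" unfolding order_def using fin LG by (rule card_mono)
  show ?thesis
  proof (cases "\<exists>y \<in> carrier G - L. card (rcosets (centralizer (y [^] (3::nat)))) = 2")
    case True
    then obtain y where y: "y \<in> carrier G - L" and two: "card (rcosets (centralizer (y [^] (3::nat)))) = 2"
      by blast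
    have "L \<subseteq> centralizer (y [^] (3::nat))"
    proof
      fix g assume g: "g \<in> L"
      then have "g [^] (3::nat) \<in> centralizer (y [^] (3::nat))"
        using y center_commute[of "g [^] (3::nat)" "y [^] (3::nat)"]
        by (simp add: L_def centralizer_def commuting_def)
      then show "g \<in> centralizer (y [^] (3::nat))"
        using index_two_cube[OF sub two] g y by (simp add: L_def)
    qed
    then have "card L \<le> c y"
      unfolding c_def using fin by (intro card_mono) (auto simp: centralizer_def)
    then have half: "2 * card L \<le> order G" using lag[of y] y two by simp
    have "2 * (\<Sum>y\<in>carrier G. c y) \<le> 2 * card L * order G + (card (carrier G) - card L) * order G"
    proof (rule sum_le_split[OF fin LG])
      show "2 * c y \<le> order G" if "y \<in> carrier G - L" for y
        using lag[of y] index[OF that] that by (metis Diff_iff mult_le_mono1)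
    qed (rule cle)
    also have "\<dots> = (order G + card L) * order G"
      using Lle by (simp add: order_def algebra_simps diff_mult_distrib2)
    finally have "4 * (\<Sum>y\<in>carrier G. c y) \<le> (2 * order G + 2 * card L) * order G"
      by (simp add: algebra_simps)
    also have "\<dots> \<le> (3 * order G) * order G" using half by (intro mult_le_mono1) simp
    finally show ?thesis unfolding c_def by (simp add: algebra_simps)
  next
    case False
    have "\<not> 7 * order G < 9 * card L"
      using cubes_in_normal[OF fin center_normal _ y0(1)] y0(2) by (auto simp: L_def)
    then have L79: "9 * card L \<le> 7 * order G" by simp
    have "3 * (\<Sum>y\<in>carrier G. c y) \<le> 3 * card L * order G + (card (carrier G) - card L) * order G"
    proof (rule sum_le_split[OF fin LG])
      show "3 * c y \<le> order G" if "y \<in> carrier G - L" for y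
      proof -
        have "card (rcosets (centralizer (y [^] (3::nat)))) \<ge> 3"
          using False index[OF that] that by (metis le_neq_implies_less Suc_leI eval_nat_numeral(3))
        then show ?thesis using lag[of y] that by (metis Diff_iff mult_le_mono1)
      qed
    qed (rule cle)
    also have "\<dots> = (order G + 2 * card L) * order G"
      using Lle by (simp add: order_def algebra_simps diff_mult_distrib2)
    finally have "27 * (\<Sum>y\<in>carrier G. c y) \<le> (9 * order G + 2 * (9 * card L)) * order G"
      by (simp add: algebra_simps)
    also have "\<dots> \<le> (23 * order G) * order G" using L79 by (intro mult_le_mono1) simp
    finally show ?thesis unfolding c_def by (simp add: algebra_simps)
  qed
qed

end

lemma eq_vars_commutes_with_cube: "eq_vars commutes_with_cube = UNIV"
proof -
  have "eq_vars commutes_with_cube = {X, Y}"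
    by (auto simp: commutes_with_cube_def Let_def)
  moreover have "{X, Y} = (UNIV :: xy set)"
    by (metis (full_types) UNIV_eq_I insert_iff xy.exhaust)
  ultimately show ?thesis by simp
qed

context group
begin

lemma satisfies_commutes_with_cube:
  assumes "t \<in> tuples G commutes_with_cube"
  shows "satisfies G t commutes_with_cube \<longleftrightarrow> t X \<in> centralizer (t Y [^] (3::nat))"
proof -
  have "t X \<in> carrier G" "t Y \<in> carrier G"
    using assms by (auto simp: tuples_def eq_vars_commutes_with_cube PiE_def Pi_def)
  then show ?thesis
    by (auto simp: commutes_with_cube_def Let_def centralizer_def commuting_def pow3 m_assoc)
qed

text \<open>Putting \<open>y\<close> first makes the satisfying tuples a dependent sum of centralizers indexed by \<open>y\<close>.\<close>

lemma bij_betw_tuples: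
  "bij_betw (\<lambda>t. (t Y, t X)) (tuples G commutes_with_cube) (carrier G \<times> carrier G)"
  by (rule bij_betwI[where g = "\<lambda>(y, x) v. case v of X \<Rightarrow> x | Y \<Rightarrow> y"])
    (auto simp: tuples_def eq_vars_commutes_with_cube fun_eq_iff split: xy.split)

lemma degree_commutes_with_cube:
  assumes fin: "finite (carrier G)"
  shows "degree_of_satisfiability G commutes_with_cube =
    real (\<Sum>y\<in>carrier G. card (centralizer (y [^] (3::nat)))) / real (order G * order G)"
proof -
  let ?T = "tuples G commutes_with_cube"
  have "card ?T = order G * order G"
    using bij_betw_same_card[OF bij_betw_tuples] by (simp add: order_def card_cartesian_product)
  moreover have "bij_betw (\<lambda>t. (t Y, t X)) {t \<in> ?T. satisfies G t commutes_with_cube}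
      (Sigma (carrier G) (\<lambda>y. centralizer (y [^] (3::nat))))"
  proof (rule bij_betw_subset[OF bij_betw_tuples])
    show "(\<lambda>t. (t Y, t X)) ` {t \<in> ?T. satisfies G t commutes_with_cube} =
        Sigma (carrier G) (\<lambda>y. centralizer (y [^] (3::nat)))"
    proof (intro equalityI subsetI)
      fix p assume "p \<in> Sigma (carrier G) (\<lambda>y. centralizer (y [^] (3::nat)))"
      then obtain x y where p: "p = (y, x)" "y \<in> carrier G" "x \<in> centralizer (y [^] (3::nat))" by blast
      then have "p \<in> carrier G \<times> carrier G" by (simp add: centralizer_def)
      then obtain t where t: "t \<in> ?T" "p = (t Y, t X)"
        using bij_betw_imp_surj_on[OF bij_betw_tuples] by blast
      then show "p \<in> (\<lambda>t. (t Y, t X)) ` {t \<in> ?T. satisfies G t commutes_with_cube}"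
        using p satisfies_commutes_with_cube[OF t(1)] by auto
    next
      fix p assume "p \<in> (\<lambda>t. (t Y, t X)) ` {t \<in> ?T. satisfies G t commutes_with_cube}"
      then obtain t where t: "t \<in> ?T" "satisfies G t commutes_with_cube" "p = (t Y, t X)" by blast
      moreover have "(t Y, t X) \<in> carrier G \<times> carrier G"
        using bij_betwE[OF bij_betw_tuples] t(1) by blast
      ultimately show "p \<in> Sigma (carrier G) (\<lambda>y. centralizer (y [^] (3::nat)))"
        using satisfies_commutes_with_cube[OF t(1)] by simp
    qed
  qed blast
  then have "card {t \<in> ?T. satisfies G t commutes_with_cube} =
      (\<Sum>y\<in>carrier G. card (centralizer (y [^] (3::nat))))"
    using fin by (simp add: bij_betw_same_card centralizer_def)
  ultimately show ?thesis by (simp add: degree_of_satisfiability_def)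
qed

end

theorem proposition2p9:
  "has_finite_satisfiability_gap TYPE('a) commutes_with_cube (4 / 27)"
  unfolding has_finite_satisfiability_gap_def
proof (intro conjI allI impI)
  show "(4 / 27 :: real) > 0" by simp
next
  fix G :: "'a monoid"
  assume G: "group G \<and> finite (carrier G)"
  then interpret group G by simp
  have fin: "finite (carrier G)" using G by simp
  let ?s = "\<Sum>y\<in>carrier G. card (centralizer (y [^]\<^bsub>G\<^esub> (3::nat)))"
  have nz: "order G > 0" using fin by (simp add: order_gt_0_iff_finite)
  show "degree_of_satisfiability G commutes_with_cube = 1 \<or>
      degree_of_satisfiability G commutes_with_cube \<le> 1 - 4 / 27"
  proof (cases "\<forall>y \<in> carrier G. y [^]\<^bsub>G\<^esub> (3::nat) \<in> center G")
    case True
    then have "centralizer (y [^]\<^bsub>G\<^esub> (3::nat)) = carrier G" if "y \<in> carrier G" for y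
      using that by (auto simp: centralizer_def center_def commuting_def)
    then have "?s = order G * order G" by (simp add: order_def)
    then show ?thesis using nz by (simp add: degree_commutes_with_cube[OF fin])
  next
    case False
    then have "27 * ?s \<le> 23 * (order G * order G)"
      using card_commuting_with_cube_le[OF fin] by blast
    then have "real (27 * ?s) \<le> real (23 * (order G * order G))" by (simp only: of_nat_le_iff)
    then have "27 * real ?s \<le> 23 * real (order G * order G)" by (simp only: of_nat_mult of_nat_numeral)
    moreover have "real (order G * order G) > 0" using nz by simp
    ultimately have "real ?s / real (order G * order G) \<le> 23 / 27"
      by (subst pos_divide_le_eq) simp_all
    then show ?thesis by (simp only: degree_commutes_with_cube[OF fin]) simp
  qed
qed

end
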